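(* Consider the reflected chain $X$ on an infinite tree, assumed transient with all points of $\partial_\infty$ regular. Let $\mu(\bullet)=\mathbb P_r\{X_\zeta\in\bullet\}$, $G_0(\eta):=\int_{\partial_\infty}U_{\eta\xi}\,\mathbb P_r\{X_\zeta\in d\xi\}$ and, for $k\ge1$, $G_k:=\lim_{a\to\infty}G_k^{(a)}$. Then $G_0(\eta)=V_{rr}+w_0$ is a constant, and $(G_k:k\ge1)$ is a positive decreasing predictable process that verifies $$G_k(\eta)=G_0-\sum_{n=0}^{k-1}\Delta_n(w)\,\mu(C^n(\eta))=\sum_{n\ge k}\Delta_n(w)\,\mu(C^n(\eta))\quad\text{for }k\ge1;$$ and the Martin kernel satisfies, for $i\in I$, $\eta\in\partial_\infty$, $$\kappa(i,\eta)=1+\sum_{k=1}^{|i\wedge\eta|+1}\frac1{G_k(\eta)}\big(\mathbb E_\mu(U_{i\bullet}|\mathcal F_k)(\eta)-\mathbb E_\mu(U_{i\bullet}|\mathcal F_{k-1})(\eta)\big).$$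
   Context: Tree and matrix. $(I,\mathcal T)$ is a connected, locally finite, non-oriented tree with countably infinite set of sites $I$ and root $r$, every branch being infinite (each site has at least one successor). $|i|$ is the distance from $i$ to $r$; $i^-$ ($i\ne r$) is the neighbour of $i$ closer to $r$; $S_i=\{j:j^-=i\}$; $i\wedge j$ is the common vertex, farthest from $r$, of the geodesics from $r$ to $i$ and to $j$. $w:\mathbb N=\{0,1,\dots\}\to(0,\infty)$ is strictly increasing, $w_{-1}=0$, $\Delta_n(w)=w_n-w_{n-1}$ for $n\ge0$. $U_{ij}=w_{|i\wedge j|}$. Reflected $q$-matrix. $Q_{ii^-}=Q_{i^-i}=(w_{|i|}-w_{|i|-1})^{-1}$ for $i\neq r$; $Q_{ii}=-\big((w_{|i|}-w_{|i|-1})^{-1}+|S_i|(w_{|i|+1}-w_{|i|})^{-1}\big)$ for $i\ne r$; $Q_{rr}=-|S_r|/(w_1-w_0)$; $0$ otherwise ($Q$ is conservative). $X$ is the minimal continuous-time Markov chain on $I$ with $q$-matrix $Q$, with lifetime $\zeta$ (explosion time, possibly $\infty$). Boundary. $\partial_\infty$ is the set of infinite geodesic rays $\xi=(\xi(n))_{n\ge0}$ with $\xi(0)=r$, $\xi(n+1)\in S_{\xi(n)}$, with the compact topology generated by the sets $\partial_\infty(i)=\{\xi:\xi(|i|)=i\}$; $C^n(\xi)=\partial_\infty(\xi(n))$. For $\xi\neq\eta$, $U_{\xi\eta}=w_{|\xi\wedge\eta|}$ with $|\xi\wedge\eta|=\max\{n:\xi(n)=\eta(n)\}$, $U_{\xi\xi}=\lim_nw_n$;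 $U_{i\xi}=w_{|i\wedge\xi|}$ with $|i\wedge\xi|$ the largest level of a common vertex of the geodesic from $r$ to $i$ and the ray $\xi$. $j\to\eta$ (for $j\in I$) means that for every $n$ eventually $\eta(n)$ lies on the geodesic from $r$ to $j$. Assumptions. The chain is transient: $\mathbb P_r\{X_\zeta\in\partial_\infty\}=1$, where $X_\zeta=\lim_{t\uparrow\zeta}X_t$. All points are regular: for every $\eta\in\partial_\infty$ and $i\in I$, $\lim_{j\to\eta}\mathbb P_j\{T_i<\infty\}=0$, $T_i$ being the hitting time of $i$. $V_{ij}=\mathbb E_i\int_0^\zeta\mathbf 1_{\{X_t=j\}}dt$; $\kappa(i,\eta)=\lim_{j\to\eta}V_{ij}/V_{rj}$. $\mathcal F_n$ is the finite $\sigma$-field generated by $\{\partial_\infty(i):|i|=n\}$; $\mathbb E_\mu(f|\mathcal F_k)(\eta)=\mu(C^k(\eta))^{-1}\int_{C^k(\eta)}f\,d\mu$; predictable means $G_k$ is $\mathcal F_{k-1}$-measurable. Approximations. For $a>0$ put $w^{(a)}_n=w_n+a$ for $n\ge0$, $w^{(a)}_{-1}=0$. Let $Q^{(a)}$ be equal to $Q$ except that $Q^{(a)}_{rr}=Q_{rr}-\frac1{w_0+a}$; its chain $X^{(a)}$ is $X$ killed at a time $T^{(a)}$, the killing occurring at rate $1/(w_0+a)$ while $X$ is at $r$. Let $\mu^{(a)}(\bullet)=\mathbb P_r\{X_\zeta\in\bullet\mid\zeta\le T^{(a)}\}$ (on $\{\zeta\le T^{(a)}\}$ there is no killing before the lifetime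 $\zeta$ of $X$) and $G^{(a)}_k(\eta)=\sum_{n\ge k}(w^{(a)}_n-w^{(a)}_{n-1})\,\mu^{(a)}(C^n(\eta))$. *)

theory Defs
  imports "HOL-Probability.Probability"
begin

section \<open>Rooted trees and their boundary\<close>

text \<open>The set of sites \<open>I\<close> is the whole type \<open>'v\<close>; the tree is its adjacency relation \<open>T\<close>.\<close>

definition simple_path :: "('v \<times> 'v) set \<Rightarrow> 'v list \<Rightarrow> bool" where
  "simple_path T xs \<longleftrightarrow> xs \<noteq> [] \<and> distinct xs \<and> successively (\<lambda>i j. (i, j) \<in> T) xs"

definition is_tree :: "('v \<times> 'v) set \<Rightarrow> bool" where
  "is_tree T \<longleftrightarrow> sym T \<and> irrefl T \<and>
     (\<forall>i j. \<exists>!xs. simple_path T xs \<and> hd xs = i \<and> last xs = j)"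

definition locally_finite :: "('v \<times> 'v) set \<Rightarrow> bool" where
  "locally_finite T \<longleftrightarrow> (\<forall>i. finite {j. (i, j) \<in> T})"

definition geodesic :: "('v \<times> 'v) set \<Rightarrow> 'v \<Rightarrow> 'v \<Rightarrow> 'v list" where
  "geodesic T i j = (THE xs. simple_path T xs \<and> hd xs = i \<and> last xs = j)"

definition level :: "('v \<times> 'v) set \<Rightarrow> 'v \<Rightarrow> 'v \<Rightarrow> nat" where
  "level T r i = length (geodesic T r i) - 1"

text \<open>\<open>i\<^sup>-\<close>; only meaningful for \<open>i \<noteq> r\<close>.\<close>

definition parent :: "('v \<times> 'v) set \<Rightarrow> 'v \<Rightarrow> 'v \<Rightarrow> 'v" where
  "parent T r i = (THE j. (i, j) \<in> T \<and> level T r j < level T r i)"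

definition succs :: "('v \<times> 'v) set \<Rightarrow> 'v \<Rightarrow> 'v \<Rightarrow> 'v set" where
  "succs T r i = {j. j \<noteq> r \<and> parent T r j = i}"

definition rays :: "('v \<times> 'v) set \<Rightarrow> 'v \<Rightarrow> (nat \<Rightarrow> 'v) set" where
  "rays T r = {\<xi>. \<xi> 0 = r \<and> (\<forall>n. \<xi> (Suc n) \<in> succs T r (\<xi> n))}"

definition rays_through :: "('v \<times> 'v) set \<Rightarrow> 'v \<Rightarrow> 'v \<Rightarrow> (nat \<Rightarrow> 'v) set" where
  "rays_through T r i = {\<xi> \<in> rays T r. \<xi> (level T r i) = i}"

definition cyl :: "('v \<times> 'v) set \<Rightarrow> 'v \<Rightarrow> nat \<Rightarrow> (nat \<Rightarrow> 'v) \<Rightarrow> (nat \<Rightarrow> 'v) set" where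
  "cyl T r n \<xi> = rays_through T r (\<xi> n)"

definition boundary_field :: "('v \<times> 'v) set \<Rightarrow> 'v \<Rightarrow> nat \<Rightarrow> (nat \<Rightarrow> 'v) measure" where
  "boundary_field T r n = sigma (rays T r) {rays_through T r i | i. level T r i = n}"

text \<open>The filter of sites \<open>j \<rightarrow> \<eta>\<close>.\<close>

definition toward :: "('v \<times> 'v) set \<Rightarrow> 'v \<Rightarrow> (nat \<Rightarrow> 'v) \<Rightarrow> 'v filter" where
  "toward T r \<eta> = (INF n. principal {j. \<eta> n \<in> set (geodesic T r j)})"

definition meet_level :: "('v \<times> 'v) set \<Rightarrow> 'v \<Rightarrow> 'v \<Rightarrow> (nat \<Rightarrow> 'v) \<Rightarrow> nat" where
  "meet_level T r i \<xi> = Max (level T r ` (set (geodesic T r i) \<inter> range \<xi>))"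

section \<open>The tree matrix and the reflected q-matrix\<close>

definition Delta :: "(nat \<Rightarrow> real) \<Rightarrow> nat \<Rightarrow> real" where
  "Delta w n = w n - (if n = 0 then 0 else w (n - 1))"

definition U_site :: "('v \<times> 'v) set \<Rightarrow> 'v \<Rightarrow> (nat \<Rightarrow> real) \<Rightarrow> 'v \<Rightarrow> (nat \<Rightarrow> 'v) \<Rightarrow> real" where
  "U_site T r w i \<xi> = w (meet_level T r i \<xi>)"

text \<open>On the diagonal the value is \<open>lim w\<close>, which may be infinite.\<close>

definition U_bdry :: "(nat \<Rightarrow> real) \<Rightarrow> (nat \<Rightarrow> 'v) \<Rightarrow> (nat \<Rightarrow> 'v) \<Rightarrow> ennreal" where
  "U_bdry w \<eta> \<xi> = (if \<eta> = \<xi> then lim (\<lambda>n. ennreal (w n))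
                    else ennreal (w (Max {n. \<eta> n = \<xi> n})))"

definition reflected_Q :: "('v \<times> 'v) set \<Rightarrow> 'v \<Rightarrow> (nat \<Rightarrow> real) \<Rightarrow> 'v \<Rightarrow> 'v \<Rightarrow> real" where
  "reflected_Q T r w i j =
     (if i = j then
        - ((if i = r then 0 else 1 / (w (level T r i) - w (level T r i - 1)))
           + card (succs T r i) / (w (level T r i + 1) - w (level T r i)))
      else if i \<noteq> r \<and> j = parent T r i then 1 / (w (level T r i) - w (level T r i - 1))
      else if j \<noteq> r \<and> i = parent T r j then 1 / (w (level T r j) - w (level T r j - 1))
      else 0)"

section \<open>Minimal chains\<close>

text \<open>
  The minimal chain is given by its jump chain \<open>Y\<close> and its holding times \<open>S\<close>, under a family
  \<open>P\<close> of laws indexed by the starting site. Given \<open>Y\<close>, the holding times are independent,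
  \<open>S n\<close> being exponential with parameter \<open>- Q (Y n) (Y n)\<close>. The definition is meant for
  conservative \<open>Q\<close> whose diagonal entries are all nonzero (no absorbing site).
\<close>

definition jump_prob :: "('v \<Rightarrow> 'v \<Rightarrow> real) \<Rightarrow> 'v \<Rightarrow> 'v \<Rightarrow> real" where
  "jump_prob Q i j = (if i = j then 0 else Q i j / (- Q i i))"

definition minimal_chain ::
  "('v \<Rightarrow> 'v \<Rightarrow> real) \<Rightarrow> ('v \<Rightarrow> 'w measure) \<Rightarrow> (nat \<Rightarrow> 'w \<Rightarrow> 'v) \<Rightarrow> (nat \<Rightarrow> 'w \<Rightarrow> real) \<Rightarrow> bool"
  where
  "minimal_chain Q P Y S \<longleftrightarrow>
     (\<forall>i. prob_space (P i) \<and>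
       (\<forall>n. Y n \<in> P i \<rightarrow>\<^sub>M count_space UNIV \<and> S n \<in> borel_measurable (P i) \<and>
            (\<forall>\<omega>\<in>space (P i). 0 < S n \<omega>)) \<and>
       (\<forall>n (x :: nat \<Rightarrow> 'v) (t :: nat \<Rightarrow> real). (\<forall>k. 0 \<le> t k) \<longrightarrow>
          \<P>(\<omega> in P i. \<forall>k\<le>n. Y k \<omega> = x k \<and> t k < S k \<omega>) =
            (if x 0 = i then 1 else 0) * (\<Prod>k<n. jump_prob Q (x k) (x (Suc k)))
              * (\<Prod>k\<le>n. exp (Q (x k) (x k) * t k))))"

text \<open>\<open>None\<close> is the value outside \<open>[0, \<zeta>)\<close>.\<close>

definition chain_path ::
  "(nat \<Rightarrow> 'w \<Rightarrow> 'v) \<Rightarrow> (nat \<Rightarrow> 'w \<Rightarrow> real) \<Rightarrow> real \<Rightarrow> 'w \<Rightarrow> 'v option" where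
  "chain_path Y S t \<omega> =
     (if 0 \<le> t \<and> (\<exists>n. t < (\<Sum>k\<le>n. S k \<omega>))
      then Some (Y (LEAST n. t < (\<Sum>k\<le>n. S k \<omega>)) \<omega>) else None)"

definition lifetime :: "(real \<Rightarrow> 'w \<Rightarrow> 'v option) \<Rightarrow> 'w \<Rightarrow> ennreal" where
  "lifetime X \<omega> = Sup {ennreal t | t. 0 \<le> t \<and> X t \<omega> \<noteq> None}"

definition hitting_time :: "(real \<Rightarrow> 'w \<Rightarrow> 'v option) \<Rightarrow> 'v \<Rightarrow> 'w \<Rightarrow> ennreal" where
  "hitting_time X i \<omega> = Inf {ennreal t | t. 0 \<le> t \<and> X t \<omega> = Some i}"

definition potential ::
  "('v \<Rightarrow> 'w measure) \<Rightarrow> (real \<Rightarrow> 'w \<Rightarrow> 'v option) \<Rightarrow> 'v \<Rightarrow> 'v \<Rightarrow> ennreal" where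
  "potential P X i j =
     (\<integral>\<^sup>+\<omega>. (\<integral>\<^sup>+t. indicator {t. 0 \<le> t \<and> ennreal t < lifetime X \<omega> \<and> X t \<omega> = Some j} t \<partial>lborel) \<partial>P i)"

text \<open>\<open>X\<^sub>\<zeta> = \<xi>\<close>, that is, \<open>X\<^sub>t \<rightarrow> \<xi>\<close> as \<open>t\<close> increases to \<open>\<zeta>\<close>.\<close>

definition exits_at ::
  "('v \<times> 'v) set \<Rightarrow> 'v \<Rightarrow> (real \<Rightarrow> 'w \<Rightarrow> 'v option) \<Rightarrow> 'w \<Rightarrow> (nat \<Rightarrow> 'v) \<Rightarrow> bool" where
  "exits_at T r X \<omega> \<xi> \<longleftrightarrow>
     filterlim (\<lambda>t. the (X t \<omega>)) (toward T r \<xi>)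
       (if lifetime X \<omega> = \<top> then at_top else at_left (enn2real (lifetime X \<omega>)))"

text \<open>The exit measure, on the Borel sets of the boundary: the sets \<^term>\<open>rays_through T r i\<close>
  form a countable base of the topology.\<close>

definition exit_law ::
  "('v \<times> 'v) set \<Rightarrow> 'v \<Rightarrow> 'w measure \<Rightarrow> (real \<Rightarrow> 'w \<Rightarrow> 'v option) \<Rightarrow> (nat \<Rightarrow> 'v) measure" where
  "exit_law T r M X = measure_of (rays T r) (range (rays_through T r))
     (\<lambda>A. emeasure M {\<omega> \<in> space M. \<exists>\<xi>\<in>A. exits_at T r X \<omega> \<xi>})"

text \<open>\<open>\<theta>\<close> is an exponential clock of parameter 1, independent of the chain. The chain with
  q-matrix \<open>Q\<close>, minus \<open>1 / (w 0 + a)\<close> at the entry \<open>(r, r)\<close>, is \<open>X\<close> killed when its occupation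
  time of the root, multiplied by the killing rate \<open>1 / (w 0 + a)\<close>, reaches \<open>\<theta>\<close>.\<close>

definition exp_clock ::
  "('v \<Rightarrow> 'w measure) \<Rightarrow> (nat \<Rightarrow> 'w \<Rightarrow> 'v) \<Rightarrow> (nat \<Rightarrow> 'w \<Rightarrow> real) \<Rightarrow> ('w \<Rightarrow> real) \<Rightarrow> bool" where
  "exp_clock P Y S \<theta> \<longleftrightarrow>
     (\<forall>i. distributed (P i) lborel \<theta> (exponential_density 1) \<and>
          prob_space.indep_set (P i)
            (sets (vimage_algebra (space (P i)) \<theta> borel))
            (sets (vimage_algebra (space (P i)) (\<lambda>\<omega> n. (Y n \<omega>, S n \<omega>))
              (Pi\<^sub>M UNIV (\<lambda>n. count_space UNIV \<Otimes>\<^sub>M borel)))))"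

definition killing_time ::
  "'v \<Rightarrow> (nat \<Rightarrow> real) \<Rightarrow> (real \<Rightarrow> 'w \<Rightarrow> 'v option) \<Rightarrow> ('w \<Rightarrow> real) \<Rightarrow> real \<Rightarrow> 'w \<Rightarrow> ennreal" where
  "killing_time r w X \<theta> a \<omega> = Inf {ennreal t | t. 0 \<le> t \<and>
     ennreal (\<theta> \<omega>) \<le> ennreal (1 / (w 0 + a)) *
       (\<integral>\<^sup>+s. indicator {s. 0 \<le> s \<and> s \<le> t \<and> X s \<omega> = Some r} s \<partial>lborel)}"

section \<open>The processes \<open>G\<close> and the Martin kernel\<close>

definition mu_killed ::
  "('v \<times> 'v) set \<Rightarrow> 'v \<Rightarrow> (nat \<Rightarrow> real) \<Rightarrow> ('v \<Rightarrow> 'w measure) \<Rightarrow> (real \<Rightarrow> 'w \<Rightarrow> 'v option) \<Rightarrow>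
   ('w \<Rightarrow> real) \<Rightarrow> real \<Rightarrow> (nat \<Rightarrow> 'v) set \<Rightarrow> real" where
  "mu_killed T r w P X \<theta> a A =
     \<P>(\<omega> in P r. (\<exists>\<xi>\<in>A. exits_at T r X \<omega> \<xi>) \<bar> lifetime X \<omega> \<le> killing_time r w X \<theta> a \<omega>)"

definition G_killed ::
  "('v \<times> 'v) set \<Rightarrow> 'v \<Rightarrow> (nat \<Rightarrow> real) \<Rightarrow> ('v \<Rightarrow> 'w measure) \<Rightarrow> (real \<Rightarrow> 'w \<Rightarrow> 'v option) \<Rightarrow>
   ('w \<Rightarrow> real) \<Rightarrow> real \<Rightarrow> nat \<Rightarrow> (nat \<Rightarrow> 'v) \<Rightarrow> ennreal" where
  "G_killed T r w P X \<theta> a k \<eta> =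
     (\<Sum>m. ennreal (Delta (\<lambda>n. w n + a) (m + k) * mu_killed T r w P X \<theta> a (cyl T r (m + k) \<eta>)))"

definition G_zero ::
  "('v \<times> 'v) set \<Rightarrow> 'v \<Rightarrow> (nat \<Rightarrow> real) \<Rightarrow> ('v \<Rightarrow> 'w measure) \<Rightarrow> (real \<Rightarrow> 'w \<Rightarrow> 'v option) \<Rightarrow>
   (nat \<Rightarrow> 'v) \<Rightarrow> ennreal" where
  "G_zero T r w P X \<eta> = (\<integral>\<^sup>+\<xi>. U_bdry w \<eta> \<xi> \<partial>exit_law T r (P r) X)"

text \<open>\<open>G\<^sub>k\<close> for \<open>k \<ge> 1\<close>, as a real number.\<close>

definition G_lim ::
  "('v \<times> 'v) set \<Rightarrow> 'v \<Rightarrow> (nat \<Rightarrow> real) \<Rightarrow> ('v \<Rightarrow> 'w measure) \<Rightarrow> (real \<Rightarrow> 'w \<Rightarrow> 'v option) \<Rightarrow>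
   ('w \<Rightarrow> real) \<Rightarrow> nat \<Rightarrow> (nat \<Rightarrow> 'v) \<Rightarrow> real" where
  "G_lim T r w P X \<theta> k \<eta> = enn2real (Lim at_top (\<lambda>a. G_killed T r w P X \<theta> a k \<eta>))"

definition martin_kernel ::
  "('v \<times> 'v) set \<Rightarrow> 'v \<Rightarrow> ('v \<Rightarrow> 'w measure) \<Rightarrow> (real \<Rightarrow> 'w \<Rightarrow> 'v option) \<Rightarrow>
   'v \<Rightarrow> (nat \<Rightarrow> 'v) \<Rightarrow> real" where
  "martin_kernel T r P X i \<eta> =
     enn2real (Lim (toward T r \<eta>) (\<lambda>j. potential P X i j / potential P X r j))"

definition cond_mean ::
  "('v \<times> 'v) set \<Rightarrow> 'v \<Rightarrow> (nat \<Rightarrow> 'v) measure \<Rightarrow> ((nat \<Rightarrow> 'v) \<Rightarrow> real) \<Rightarrow> nat \<Rightarrow>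
   (nat \<Rightarrow> 'v) \<Rightarrow> real" where
  "cond_mean T r \<mu> f k \<eta> = (LINT \<xi>:cyl T r k \<eta>|\<mu>. f \<xi>) / measure \<mu> (cyl T r k \<eta>)"

end

theory Submission
  imports Defs
begin

text \<open>
  Everything is expressed through the Green function \<open>g i = V\<^sub>i\<^sub>r = V\<^sub>r\<^sub>i\<close>. The net number of crossings of
  an edge from \<open>i\<^sup>-\<close> to \<open>i\<close> telescopes in time, so its mean is the probability of ending in the branch
  at \<open>i\<close>; by reversibility this reads \<open>g i\<^sup>- - g i = \<Delta> \<mu>(\<partial>\<^sub>\<infinity>(i))\<close> with \<open>\<Delta>\<close> taken at the level of \<open>i\<close>.
  Regularity gives \<open>g \<rightarrow> 0\<close> along every ray, hence the tail sums of \<open>\<Delta> \<mu>\<close> along \<open>\<eta>\<close> from level \<open>k \<ge> 1\<close>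
  on are \<open>g (\<eta> (k - 1))\<close>, which is therefore the value of \<open>G\<^sub>k\<close>; the killed processes converge to it by
  dominated convergence, because the probability of not being killed tends to 1.

  For the Martin kernel, a path from \<open>i\<close> or \<open>r\<close> to a site far along \<open>\<eta>\<close> passes through \<open>p = \<eta> m\<close>, the
  vertex where \<open>i\<close> and \<open>\<eta>\<close> separate, so that \<open>V\<^sub>i\<^sub>j / V\<^sub>r\<^sub>j\<close> is eventually equal to \<open>V\<^sub>i\<^sub>p / V\<^sub>r\<^sub>p = g i V\<^sub>p\<^sub>p / (g p)\<^sup>2\<close>.
  First-step analysis yields a recursion for \<open>V\<^sub>p\<^sub>p / (g p)\<^sup>2\<close> along the ray, and the conditional means are
  explicit in \<open>g\<close> and \<open>\<mu>\<close>; the claimed sum then follows by induction on its number of terms.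
\<close>

section \<open>Rooted trees\<close>

text \<open>The chain is known only through the joint laws of its jumps and holding times, and no
  shift acts on the sample space. Restarting a path is therefore a comparison of two measures of the
  family, proved for single finite paths and extended by countable additivity. Continuous time is
  removed early: potentials are jump-chain Green functions divided by holding rates, hitting and
  limit statements concern the visited sites, and survival up to the lifetime is a condition on
  partial occupation sums. Since \<open>Q\<close> is symmetric, the chain is reversible for counting
  measure, with conductance \<open>1 / Delta w\<close> on each edge. Thus \<open>g\<close> is a
  voltage and the exit law is the current through the edges, which is why differences of
  \<open>g\<close> along an edge are explicit. The restriction to \<open>k \<ge> 1\<close> comes
  from the shift of \<open>w\<close> by \<open>a\<close>: it changes only the increment at level 0,
  which becomes \<open>w 0 + a\<close> and diverges. That \<open>\<mu>\<close> charges every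
  cylinder, so that conditional means make sense, follows from the positivity of
  \<open>g\<close>.\<close>

locale rooted_tree =
  fixes T :: "('v \<times> 'v) set" and r :: 'v
  assumes tree: "is_tree T"
begin

abbreviation geo :: "'v \<Rightarrow> 'v list" where "geo \<equiv> geodesic T r"

abbreviation lev :: "'v \<Rightarrow> nat" where "lev \<equiv> level T r"

text \<open>The subtree hanging from \<open>i\<close>. For \<open>i \<noteq> r\<close> it is joined
  to the rest of the tree by a single edge, and the separation and flow arguments are all about
  entering or leaving it.\<close>

definition below :: "'v \<Rightarrow> 'v set" where "below i = {j. i \<in> set (geo j)}"

section \<open>Geodesics from the root, parents and successors\<close>

lemma sym_adj: "(i, j) \<in> T \<Longrightarrow> (j, i) \<in> T"
  using tree by (auto simp: is_tree_def sym_def)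

lemma irrefl_adj: "(i, i) \<notin> T"
  using tree by (auto simp: is_tree_def irrefl_def)

lemma unique_path:
  assumes "simple_path T xs" "simple_path T ys" "hd xs = hd ys" "last xs = last ys"
  shows "xs = ys"
  using assms tree unfolding is_tree_def by metis

lemma geo: "simple_path T (geo i)" "hd (geo i) = r" "last (geo i) = i"
proof -
  have "\<exists>!xs. simple_path T xs \<and> hd xs = r \<and> last xs = i"
    using tree by (auto simp: is_tree_def)
  from theI'[OF this] show "simple_path T (geo i)" "hd (geo i) = r" "last (geo i) = i"
    by (auto simp: geodesic_def)
qed

lemma geo_ne [simp]: "geo i \<noteq> []"
  using geo(1)[of i] by (auto simp: simple_path_def)

lemma geo_eqI: "simple_path T xs \<Longrightarrow> hd xs = r \<Longrightarrow> last xs = i \<Longrightarrow> geo i = xs"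
  using unique_path[OF geo(1)] geo by metis

lemma geo_root [simp]: "geo r = [r]"
  by (rule geo_eqI) (auto simp: simple_path_def)

lemma length_geo: "length (geo i) = Suc (lev i)"
  using geo_ne[of i] by (simp add: level_def del: geo_ne)

lemma simple_path_prefix: "simple_path T (xs @ ys) \<Longrightarrow> xs \<noteq> [] \<Longrightarrow> simple_path T xs"
  by (auto simp: simple_path_def successively_append_iff)

lemma simple_path_suffix: "simple_path T (xs @ ys) \<Longrightarrow> ys \<noteq> [] \<Longrightarrow> simple_path T ys"
  by (auto simp: simple_path_def successively_append_iff)

lemma geo_prefix: "geo j = xs @ i # ys \<Longrightarrow> geo i = xs @ [i]"
  using geo(1,2)[of j] simple_path_prefix[of "xs @ [i]" ys]
  by (intro geo_eqI) (auto simp: hd_append split: if_splits)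

text \<open>If \<open>j\<close> is off the geodesic to \<open>i\<close>, appending it gives a simple
  path. If it is on it, the segment from \<open>j\<close> to \<open>i\<close> competes with the edge
  itself, and uniqueness of paths makes them equal.\<close>

lemma geo_adj:
  assumes "(i, j) \<in> T"
  shows "geo j = geo i @ [j] \<or> geo i = geo j @ [i]"
proof (cases "j \<in> set (geo i)")
  case False
  have "simple_path T (geo i @ [j])"
    using geo(1,3)[of i] False assms by (auto simp: simple_path_def successively_append_iff)
  then have "geo j = geo i @ [j]"
    using geo(2)[of i] by (intro geo_eqI) auto
  then show ?thesis ..
next
  case True
  then obtain as bs where s: "geo i = as @ j # bs"
    by (meson split_list)
  have "simple_path T (j # bs)"
    using geo(1)[of i] unfolding s by (rule simple_path_suffix) simp
  moreover have "simple_path T [j, i]"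
    using sym_adj[OF assms] irrefl_adj by (auto simp: simple_path_def)
  moreover have "last (j # bs) = i"
    using geo(3)[of i] s by simp
  ultimately have "j # bs = [j, i]"
    by (intro unique_path) auto
  then have "geo i = geo j @ [i]"
    using s geo_prefix[OF s] by simp
  then show ?thesis ..
qed

text \<open>The last but one vertex of \<open>geo j\<close> is the only neighbour of smaller level,
  so the definite description in \<open>parent\<close> is met.\<close>

lemma geo_parent:
  assumes "j \<noteq> r"
  shows "geo j = geo (parent T r j) @ [j]" "(parent T r j, j) \<in> T"
proof -
  define xs where "xs = butlast (geo j)"
  have s: "geo j = xs @ [j]"
    using geo(3)[of j] append_butlast_last_id[OF geo_ne, of j] by (simp add: xs_def)
  have "xs \<noteq> []"
    using s geo(2)[of j] assms by auto
  then obtain ys k where k: "xs = ys @ [k]"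
    by (metis append_butlast_last_id)
  have gk: "geo k = ys @ [k]"
    using s k geo_prefix[of j ys k "[j]"] by simp
  have kj: "(k, j) \<in> T"
    using geo(1)[of j] unfolding s k by (auto simp: simple_path_def successively_append_iff)
  have "parent T r j = k"
    unfolding parent_def
  proof (rule the_equality)
    show "(j, k) \<in> T \<and> lev k < lev j"
      using sym_adj[OF kj] gk s k by (simp add: level_def)
  next
    fix l assume l: "(j, l) \<in> T \<and> lev l < lev j"
    then consider "geo l = geo j @ [l]" | "geo j = geo l @ [j]"
      using geo_adj by blast
    then show "l = k"
    proof cases
      case 1
      then show ?thesis using l length_geo[of j] length_geo[of l] by simp
    next
      case 2
      then have "geo l = geo k" using s k gk by simp
      then show ?thesis using geo(3) by metis
    qed
  qed
  then show "geo j = geo (parent T r j) @ [j]" "(parent T r j, j) \<in> T"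
    using s k gk kj by auto
qed

text \<open>Turns succession into an equation between lists, so that facts on levels and branches
  become list computations.\<close>

lemma succs_iff: "j \<in> succs T r i \<longleftrightarrow> geo j = geo i @ [j]"
proof
  assume "j \<in> succs T r i"
  then show "geo j = geo i @ [j]"
    using geo_parent by (auto simp: succs_def)
next
  assume a: "geo j = geo i @ [j]"
  then have "j \<noteq> r"
    using geo_ne[of i] by (metis append_is_Nil_conv butlast_snoc butlast.simps(2) geo_root)
  moreover from this have "geo (parent T r j) = geo i"
    using geo_parent(1)[of j] a by simp
  then have "parent T r j = i"
    using geo(3) by metis
  ultimately show "j \<in> succs T r i"
    by (simp add: succs_def)
qed

lemma succs_adj: "j \<in> succs T r i \<Longrightarrow> (i, j) \<in> T"
  using geo_parent by (auto simp: succs_def)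

lemma adj_iff: "(i, j) \<in> T \<longleftrightarrow> j \<in> succs T r i \<or> i \<in> succs T r j"
  using geo_adj sym_adj succs_adj by (auto simp: succs_iff)

lemma tree_induct [case_names root succ]:
  assumes "Q r" and "\<And>i j. j \<in> succs T r i \<Longrightarrow> Q i \<Longrightarrow> Q j"
  shows "Q i"
proof (induction "length (geo i)" arbitrary: i rule: less_induct)
  case less
  show ?case
  proof (cases "i = r")
    case False
    then have "i \<in> succs T r (parent T r i)"
      by (simp add: succs_def)
    then show ?thesis
      using less[of "parent T r i"] geo_parent(1)[OF False] assms(2) by simp
  qed (use assms(1) in simp)
qed

section \<open>Levels and branches\<close>

lemma lev_root [simp]: "lev r = 0"
  by (simp add: level_def)

lemma lev_succs: "j \<in> succs T r i \<Longrightarrow> lev j = Suc (lev i)"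
  using length_geo[of i] length_geo[of j] by (simp add: succs_iff)

lemma below_self [simp]: "i \<in> below i"
  using geo(3)[of i] last_in_set[OF geo_ne[of i]] by (simp add: below_def)

lemma below_succs: "k \<in> succs T r j \<Longrightarrow> k \<in> below i \<longleftrightarrow> k = i \<or> j \<in> below i"
  by (auto simp: succs_iff below_def)

lemma root_below: "r \<in> below i \<longleftrightarrow> i = r"
  by (auto simp: below_def)

lemma below_trans: "j \<in> below i \<Longrightarrow> k \<in> below j \<Longrightarrow> k \<in> below i"
proof -
  assume j: "j \<in> below i" and "k \<in> below j"
  then obtain xs ys where "geo k = xs @ j # ys"
    by (auto simp: below_def dest: split_list)
  then have "set (geo j) \<subseteq> set (geo k)"
    using geo_prefix by fastforce
  then show ?thesis
    using j by (auto simp: below_def)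
qed

lemma nth_geo:
  assumes "k \<le> lev j"
  shows "geo (geo j ! k) = take (Suc k) (geo j)"
proof -
  have "geo j = take k (geo j) @ geo j ! k # drop (Suc k) (geo j)"
    using assms length_geo[of j] by (simp add: id_take_nth_drop)
  from geo_prefix[OF this] show ?thesis
    using assms length_geo[of j] by (simp add: take_Suc_conv_app_nth)
qed

lemma lev_nth_geo: "k \<le> lev j \<Longrightarrow> lev (geo j ! k) = k"
  using nth_geo[of k j] length_geo[of j] length_geo[of "geo j ! k"] by simp

lemma nth_geo_above:
  assumes "j \<in> below i"
  shows "lev i \<le> lev j" "geo j ! lev i = i"
proof -
  obtain k where "k < length (geo j)" "geo j ! k = i"
    using assms by (auto simp: below_def in_set_conv_nth)
  then show "lev i \<le> lev j" "geo j ! lev i = i"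
    using lev_nth_geo[of k j] length_geo[of j] by auto
qed

lemma below_nth_geo: "k \<le> lev j \<Longrightarrow> j \<in> below (geo j ! k)"
  using length_geo[of j] by (simp add: below_def)

lemma below_same_level: "k \<in> below i \<Longrightarrow> k \<in> below j \<Longrightarrow> lev i = lev j \<Longrightarrow> i = j"
  using nth_geo_above by metis

text \<open>The ancestors of \<open>k\<close> form a chain: \<open>geo k\<close> lists them in order
  of level.\<close>

lemma below_above_cases:
  assumes "k \<in> below i" "k \<in> below j" "lev i \<le> lev j"
  shows "j \<in> below i"
proof -
  have l: "lev j \<le> lev k" "geo k ! lev j = j"
    using nth_geo_above[OF assms(2)] by auto
  then have "geo j ! lev i = geo k ! lev i"
    using nth_geo[OF l(1)] assms(3) by simp
  then show ?thesis
    using nth_geo_above[OF assms(1)] below_nth_geo[OF assms(3)] by simp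
qed

section \<open>Rays, cylinders and convergence to the boundary\<close>

lemma rays_Suc: "\<xi> \<in> rays T r \<Longrightarrow> \<xi> (Suc n) \<in> succs T r (\<xi> n)"
  by (simp add: rays_def)

lemma rays_0: "\<xi> \<in> rays T r \<Longrightarrow> \<xi> 0 = r"
  by (simp add: rays_def)

lemma lev_rays: "\<xi> \<in> rays T r \<Longrightarrow> lev (\<xi> n) = n"
  by (induction n) (simp_all add: rays_0 lev_succs[OF rays_Suc])

lemma rays_below: "\<xi> \<in> rays T r \<Longrightarrow> k \<le> n \<Longrightarrow> \<xi> n \<in> below (\<xi> k)"
  by (induction n) (auto simp: below_succs[OF rays_Suc] le_Suc_eq)

lemma below_root [simp]: "below r = UNIV"
proof -
  have "r \<in> set (geo j)" for j
    using hd_in_set[OF geo_ne[of j]] geo(2)[of j] by simp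
  then show ?thesis
    by (auto simp: below_def)
qed

lemma rays_below_iff:
  assumes "\<xi> \<in> rays T r" "lev i \<le> n"
  shows "\<xi> n \<in> below i \<longleftrightarrow> \<xi> \<in> rays_through T r i"
  using assms below_same_level[OF _ rays_below[OF assms], of i] lev_rays[OF assms(1)]
    rays_below[OF assms]
  by (auto simp: rays_through_def)

lemma rays_through_ray: "\<xi> \<in> rays T r \<Longrightarrow>
    rays_through T r (\<xi> n) = {\<eta> \<in> rays T r. \<eta> n = \<xi> n}"
  by (auto simp: rays_through_def lev_rays)

lemma cyl_eq: "\<xi> \<in> rays T r \<Longrightarrow> cyl T r n \<xi> = {\<eta> \<in> rays T r. \<eta> n = \<xi> n}"
  by (simp add: cyl_def rays_through_ray)

lemma rays_agree_le:
  assumes "\<xi> \<in> rays T r" "\<eta> \<in> rays T r" "\<xi> n = \<eta> n" "k \<le> n"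
  shows "\<xi> k = \<eta> k"
  using below_same_level[of "\<xi> n" "\<xi> k" "\<eta> k"] rays_below[OF assms(1,4)] rays_below[OF assms(2,4)]
    lev_rays[OF assms(1)] lev_rays[OF assms(2)] assms(3)
  by simp

lemma eventually_toward:
  assumes "\<xi> \<in> rays T r"
  shows "eventually Q (toward T r \<xi>) \<longleftrightarrow> (\<exists>n. \<forall>j\<in>below (\<xi> n). Q j)"
proof -
  have "eventually Q (toward T r \<xi>) \<longleftrightarrow> (\<exists>n\<in>UNIV. eventually Q (principal (below (\<xi> n))))"
    unfolding toward_def below_def[symmetric]
  proof (rule eventually_INF_base)
    fix a b :: nat
    \<comment> \<open>The branches along a ray are nested, so the larger of the two levels serves
      both.\<close>
    show "\<exists>x\<in>UNIV. principal (below (\<xi> x)) \<le>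
        inf (principal (below (\<xi> a))) (principal (below (\<xi> b)))"
      using rays_below[OF assms, of a "max a b"] rays_below[OF assms, of b "max a b"]
      by (intro bexI[of _ "max a b"]) (auto simp: le_principal eventually_principal
          intro: below_trans)
  qed simp
  then show ?thesis
    by (simp add: eventually_principal)
qed

lemma toward_neq_bot: "\<xi> \<in> rays T r \<Longrightarrow> toward T r \<xi> \<noteq> bot"
  using eventually_toward[of \<xi> "\<lambda>_. False"] below_self
  by (fastforce simp: trivial_limit_def)

lemma filterlim_toward:
  assumes "\<xi> \<in> rays T r"
  shows "filterlim f (toward T r \<xi>) F \<longleftrightarrow> (\<forall>n. \<forall>\<^sub>F x in F. f x \<in> below (\<xi> n))"
proof
  assume "filterlim f (toward T r \<xi>) F"
  then show "\<forall>n. \<forall>\<^sub>F x in F. f x \<in> below (\<xi> n)"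
    by (auto simp: filterlim_iff eventually_toward[OF assms])
next
  assume a: "\<forall>n. \<forall>\<^sub>F x in F. f x \<in> below (\<xi> n)"
  show "filterlim f (toward T r \<xi>) F"
    unfolding filterlim_iff eventually_toward[OF assms]
  proof (intro allI impI, elim exE)
    fix Q n assume "\<forall>j\<in>below (\<xi> n). Q j"
    with spec[OF a, of n] show "\<forall>\<^sub>F x in F. Q (f x)"
      by (auto elim!: eventually_mono)
  qed
qed

lemma ray_filterlim_toward: "\<xi> \<in> rays T r \<Longrightarrow> filterlim \<xi> (toward T r \<xi>) sequentially"
  by (auto simp: filterlim_toward eventually_sequentially intro: rays_below)

text \<open>Branches behave as clopen sets: a limit ray that avoids \<open>i\<close> has another
  vertex at the level of \<open>i\<close>, and the branches of two vertices of the same level are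
  disjoint. The dichotomy lets the exit point be located from the jump chain.\<close>

lemma limit_through:
  assumes "\<xi> \<in> rays T r" "filterlim f (toward T r \<xi>) F"
  shows "\<xi> \<in> rays_through T r i \<Longrightarrow> \<forall>\<^sub>F x in F. f x \<in> below i"
    and "\<xi> \<notin> rays_through T r i \<Longrightarrow> \<forall>\<^sub>F x in F. f x \<notin> below i"
proof -
  have ev: "\<forall>\<^sub>F x in F. f x \<in> below (\<xi> (lev i))"
    using assms by (simp add: filterlim_toward)
  show "\<forall>\<^sub>F x in F. f x \<in> below i" if "\<xi> \<in> rays_through T r i"
    using ev that by (simp add: rays_through_def)
  show "\<forall>\<^sub>F x in F. f x \<notin> below i" if "\<xi> \<notin> rays_through T r i"
    using ev
  proof eventually_elim
    case (elim x)
    then show ?case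
      using below_same_level[OF elim, of i] lev_rays[OF assms(1)] that assms(1)
      by (auto simp: rays_through_def)
  qed
qed

lemma limit_ray_unique:
  assumes "\<xi> \<in> rays T r" "filterlim f (toward T r \<xi>) F"
    and "\<xi>' \<in> rays T r" "filterlim f (toward T r \<xi>') F" and "F \<noteq> bot"
  shows "\<xi> = \<xi>'"
proof
  fix n
  have "\<forall>\<^sub>F x in F. f x \<in> below (\<xi> n) \<and> f x \<in> below (\<xi>' n)"
    using assms by (auto simp: filterlim_toward intro: eventually_conj)
  then obtain x where "f x \<in> below (\<xi> n)" "f x \<in> below (\<xi>' n)"
    using eventually_happens'[OF assms(5)] by blast
  then show "\<xi> n = \<xi>' n"
    using assms lev_rays by (intro below_same_level) auto
qed

text \<open>Replaces the maximum in \<open>meet_level\<close> by a threshold condition. The root is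
  always a common vertex, so the maximum is over a nonempty set, and nested branches make the
  condition downward closed in \<open>k\<close>.\<close>

lemma le_meet_level:
  assumes "\<xi> \<in> rays T r"
  shows "k \<le> meet_level T r i \<xi> \<longleftrightarrow> i \<in> below (\<xi> k)"
proof -
  let ?A = "set (geo i) \<inter> range \<xi>"
  have fin: "finite (lev ` ?A)" by simp
  have "r \<in> ?A"
    using below_root rays_0[OF assms] by (auto simp: below_def image_iff intro!: exI[of _ 0])
  then have "meet_level T r i \<xi> \<in> lev ` ?A"
    unfolding meet_level_def by (intro Max_in) auto
  then obtain m where m: "meet_level T r i \<xi> = m" "i \<in> below (\<xi> m)"
    by (auto simp: below_def lev_rays[OF assms])
  show ?thesis
  proof
    assume "k \<le> meet_level T r i \<xi>"
    then show "i \<in> below (\<xi> k)"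
      using m below_trans[OF rays_below[OF assms]] by auto
  next
    assume "i \<in> below (\<xi> k)"
    then have "k \<in> lev ` ?A"
      using lev_rays[OF assms, of k] by (auto simp: below_def image_iff intro!: bexI[of _ "\<xi> k"])
    then show "k \<le> meet_level T r i \<xi>"
      unfolding meet_level_def by (rule Max_ge[OF fin])
  qed
qed

lemma meet_level_le: "\<xi> \<in> rays T r \<Longrightarrow> meet_level T r i \<xi> \<le> lev i"
  using le_meet_level[of \<xi> "meet_level T r i \<xi>" i] nth_geo_above(1)[of i "\<xi> (meet_level T r i \<xi>)"]
    lev_rays[of \<xi> "meet_level T r i \<xi>"]
  by simp

end

section \<open>Discrete-time Markov families\<close>

text \<open>Countable additivity extends a product formula from single values of a discrete
  statistic to sets of values. \<open>M\<close> and \<open>N\<close> may differ, because the Markov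
  property compares laws for two starting sites.\<close>

lemma measure_countable_decomp:
  fixes f :: "'w \<Rightarrow> 'b :: countable" and g :: "'u \<Rightarrow> 'b"
  assumes "finite_measure M" "finite_measure N"
    and f: "f \<in> M \<rightarrow>\<^sub>M count_space UNIV" and g: "g \<in> N \<rightarrow>\<^sub>M count_space UNIV"
    and E: "{\<omega> \<in> space M. E \<omega>} \<in> sets M" and K: "0 \<le> K"
    and eq: "\<And>y. y \<in> C \<Longrightarrow>
      measure M {\<omega> \<in> space M. f \<omega> = y \<and> E \<omega>} = K * measure N {\<omega> \<in> space N. g \<omega> = y}"
  shows "measure M {\<omega> \<in> space M. f \<omega> \<in> C \<and> E \<omega>} = K * measure N {\<omega> \<in> space N. g \<omega> \<in> C}"
proof -
  interpret M: finite_measure M by fact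
  interpret N: finite_measure N by fact
  note [measurable] = f g E
  have "emeasure M {\<omega> \<in> space M. f \<omega> \<in> C \<and> E \<omega>}
      = emeasure M (\<Union>y\<in>C. {\<omega> \<in> space M. f \<omega> = y \<and> E \<omega>})"
    by (rule arg_cong[where f = "emeasure M"]) auto
  also have "\<dots> = (\<integral>\<^sup>+y. emeasure M {\<omega> \<in> space M. f \<omega> = y \<and> E \<omega>} \<partial>count_space C)"
    by (rule emeasure_UN_countable) (auto simp: disjoint_family_on_def)
  also have "\<dots> = (\<integral>\<^sup>+y. ennreal K * emeasure N {\<omega> \<in> space N. g \<omega> = y} \<partial>count_space C)"
    by (rule nn_integral_cong)
      (simp add: eq K M.emeasure_eq_measure N.emeasure_eq_measure ennreal_mult)
  also have "\<dots> = ennreal K * (\<integral>\<^sup>+y. emeasure N {\<omega> \<in> space N. g \<omega> = y} \<partial>count_space C)"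
    by (rule nn_integral_cmult) simp
  also have "(\<integral>\<^sup>+y. emeasure N {\<omega> \<in> space N. g \<omega> = y} \<partial>count_space C)
      = emeasure N (\<Union>y\<in>C. {\<omega> \<in> space N. g \<omega> = y})"
    by (rule emeasure_UN_countable[symmetric]) (auto simp: disjoint_family_on_def)
  also have "(\<Union>y\<in>C. {\<omega> \<in> space N. g \<omega> = y}) = {\<omega> \<in> space N. g \<omega> \<in> C}"
    by auto
  finally show ?thesis
    by (simp add: M.emeasure_eq_measure N.emeasure_eq_measure K flip: ennreal_mult)
qed

text \<open>The Cauchy product without summability conditions: the order of summation is exchanged
  by Tonelli for counting measure.\<close>

lemma suminf_ennreal_triangle:
  fixes a b :: "nat \<Rightarrow> ennreal"
  shows "(\<Sum>n. \<Sum>k\<le>n. a k * b (n - k)) = (\<Sum>k. a k) * (\<Sum>n. b n)"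
proof -
  have "(\<Sum>n. \<Sum>k\<le>n. a k * b (n - k))
      = (\<Sum>n. \<Sum>k. if k \<le> n then a k * b (n - k) else 0)"
  proof (intro suminf_cong)
    fix n
    show "(\<Sum>k\<le>n. a k * b (n - k)) = (\<Sum>k. if k \<le> n then a k * b (n - k) else 0)"
      by (subst suminf_finite[of "{..n}"]) (auto intro!: sum.cong)
  qed
  also have "\<dots> = (\<Sum>k. \<Sum>n. if k \<le> n then a k * b (n - k) else 0)"
    using nn_integral_fst_count_space[of "\<lambda>(n, k). if k \<le> n then a k * b (n - k) else 0"]
      nn_integral_snd_count_space[of "\<lambda>(n, k). if k \<le> n then a k * b (n - k) else 0"]
    by (simp add: nn_integral_count_space_nat)
  also have "\<dots> = (\<Sum>k. a k * (\<Sum>n. b n))"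
  proof (rule suminf_cong)
    fix k
    have "(\<Sum>n. if k \<le> n then a k * b (n - k) else 0)
        = (\<Sum>n. if k \<le> n + k then a k * b (n + k - k) else 0)
          + (\<Sum>n<k. if k \<le> n then a k * b (n - k) else 0)"
      by (rule suminf_offset) simp
    then show "(\<Sum>n. if k \<le> n then a k * b (n - k) else 0) = a k * (\<Sum>n. b n)"
      by (simp add: ennreal_suminf_cmult)
  qed
  finally show ?thesis
    by (simp add: ennreal_suminf_multc)
qed

locale markov_family =
  fixes P :: "'v :: countable \<Rightarrow> 'w measure" and Y :: "nat \<Rightarrow> 'w \<Rightarrow> 'v" and p :: "'v \<Rightarrow> 'v \<Rightarrow> real"
  assumes prob_space_P: "prob_space (P i)"
    and measurable_Y [measurable]: "Y n \<in> P i \<rightarrow>\<^sub>M count_space UNIV"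
    and p_nonneg: "0 \<le> p i j"
    and law: "measure (P i) {\<omega> \<in> space (P i). \<forall>k\<le>n. Y k \<omega> = x k} =
      (if x 0 = i then 1 else 0) * (\<Prod>k<n. p (x k) (x (Suc k)))"
begin

section \<open>Finite path blocks and the Markov property\<close>

lemma finite_P: "finite_measure (P i)"
  using prob_space_P by (simp add: prob_space_def)

lemma prob_le_1: "measure (P i) A \<le> 1"
  using prob_space.prob_le_1[OF prob_space_P] .

lemma emeasure_P: "emeasure (P i) A = ennreal (measure (P i) A)"
  using finite_measure.emeasure_eq_measure[OF finite_P] .

text \<open>Lists over a countable type are again countable, so an event on finitely many steps can
  be split into single paths.\<close>

definition path :: "nat \<Rightarrow> nat \<Rightarrow> 'w \<Rightarrow> 'v list" where
  "path m n \<omega> = map (\<lambda>l. Y (m + l) \<omega>) [0..<Suc n]"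

lemma path_eq_iff: "length xs = Suc n \<Longrightarrow> path m n \<omega> = xs \<longleftrightarrow> (\<forall>l\<le>n. Y (m + l) \<omega> = xs ! l)"
  by (auto simp: path_def list_eq_iff_nth_eq less_Suc_eq_le simp del: upt_Suc)

lemma length_path [simp]: "length (path m n \<omega>) = Suc n"
  by (simp add: path_def)

lemma path_nth [simp]: "l \<le> n \<Longrightarrow> path m n \<omega> ! l = Y (m + l) \<omega>"
  by (simp add: path_def less_Suc_eq_le del: upt_Suc)

lemma measurable_path [measurable]: "path m n \<in> P i \<rightarrow>\<^sub>M count_space UNIV"
proof (subst measurable_count_space_eq2_countable, intro conjI ballI)
  fix xs :: "'v list"
  show "path m n -` {xs} \<inter> space (P i) \<in> sets (P i)"
  proof (cases "length xs = Suc n")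
    case True
    then have "path m n -` {xs} \<inter> space (P i) = {\<omega> \<in> space (P i). \<forall>l\<le>n. Y (m + l) \<omega> = xs ! l}"
      by (auto simp: path_eq_iff)
    then show ?thesis by simp
  next
    case False
    then have "path m n -` {xs} \<inter> space (P i) = {}" by auto
    then show ?thesis by simp
  qed
qed auto

lemma law_concat:
  "measure (P i) {\<omega> \<in> space (P i). (\<forall>k\<le>n. Y k \<omega> = x k) \<and> (\<forall>l\<le>m. Y (n + l) \<omega> = y l)}
    = measure (P i) {\<omega> \<in> space (P i). \<forall>k\<le>n. Y k \<omega> = x k}
      * measure (P (x n)) {\<omega> \<in> space (P (x n)). \<forall>l\<le>m. Y l \<omega> = y l}"
proof (cases "y 0 = x n")
  case False
  then have "{\<omega> \<in> space (P i). (\<forall>k\<le>n. Y k \<omega> = x k) \<and> (\<forall>l\<le>m. Y (n + l) \<omega> = y l)} = {}"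
    by (auto dest!: spec[of _ n] spec[of _ 0])
  then show ?thesis
    using False by (simp add: law del: Collect_empty_eq)
next
  case True
  \<comment> \<open>The two paths are glued at time \<open>n\<close>; in this case
    \<open>y 0 = x n\<close>, so the junction is consistent and the transition products
    multiply.\<close>
  define z where "z k = (if k \<le> n then x k else y (k - n))" for k
  have z: "z (n + l) = y l" for l
    using True by (cases l) (auto simp: z_def)
  have "{\<omega> \<in> space (P i). (\<forall>k\<le>n. Y k \<omega> = x k) \<and> (\<forall>l\<le>m. Y (n + l) \<omega> = y l)}
      = {\<omega> \<in> space (P i). \<forall>k\<le>n + m. Y k \<omega> = z k}"
  proof (intro Collect_cong conj_cong refl)
    fix \<omega>
    have "(\<forall>k\<le>n + m. Y k \<omega> = z k) \<longleftrightarrow> (\<forall>k\<le>n. Y k \<omega> = z k) \<and> (\<forall>l\<le>m. Y (n + l) \<omega> = z (n + l))"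
    proof (intro iffI conjI allI impI)
      fix k assume *: "(\<forall>k\<le>n. Y k \<omega> = z k) \<and> (\<forall>l\<le>m. Y (n + l) \<omega> = z (n + l))" "k \<le> n + m"
      show "Y k \<omega> = z k"
      proof (cases "k \<le> n")
        case False
        with * show ?thesis
          by (auto dest!: conjunct2 spec[of _ "k - n"])
      qed (use * in simp)
    qed auto
    then show "((\<forall>k\<le>n. Y k \<omega> = x k) \<and> (\<forall>l\<le>m. Y (n + l) \<omega> = y l)) = (\<forall>k\<le>n + m. Y k \<omega> = z k)"
      by (auto simp: z, auto simp: z_def)
  qed
  moreover have "(\<Prod>k<n + m. p (z k) (z (Suc k)))
      = (\<Prod>k<n. p (x k) (x (Suc k))) * (\<Prod>l<m. p (y l) (y (Suc l)))"
  proof (induction m)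
    case 0
    show ?case
      by (auto simp: z_def intro!: prod.cong)
  next
    case (Suc m)
    then show ?case
      using z[of m] z[of "Suc m"] by simp
  qed
  moreover have "z 0 = x 0"
    by (simp add: z_def)
  ultimately show ?thesis
    using True by (simp add: law)
qed

text \<open>Common to the Markov property, where \<open>E\<close> concerns later steps, and to the
  holding times, where \<open>E\<close> is \<open>t < S n \<omega>\<close>: in both the conditional
  probability of \<open>E\<close> depends on the prefix only through its last site.\<close>

lemma measure_prefix_decomp:
  assumes "{\<omega> \<in> space (P i). E \<omega>} \<in> sets (P i)" "0 \<le> c"
    and "\<And>x. x n = a \<Longrightarrow> measure (P i) {\<omega> \<in> space (P i). (\<forall>k\<le>n. Y k \<omega> = x k) \<and> E \<omega>} =
      c * measure (P i) {\<omega> \<in> space (P i). \<forall>k\<le>n. Y k \<omega> = x k}"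
  shows "measure (P i) {\<omega> \<in> space (P i). path 0 n \<omega> \<in> B \<and> Y n \<omega> = a \<and> E \<omega>} =
    c * measure (P i) {\<omega> \<in> space (P i). path 0 n \<omega> \<in> B \<and> Y n \<omega> = a}"
proof -
  let ?B = "{xs \<in> B. length xs = Suc n \<and> xs ! n = a}"
  have B: "path 0 n \<omega> \<in> B \<and> Y n \<omega> = a \<longleftrightarrow> path 0 n \<omega> \<in> ?B" for \<omega>
    by auto
  have "measure (P i) {\<omega> \<in> space (P i). path 0 n \<omega> \<in> ?B \<and> E \<omega>} =
      c * measure (P i) {\<omega> \<in> space (P i). path 0 n \<omega> \<in> ?B}"
  proof (rule measure_countable_decomp[OF finite_P finite_P _ _ assms(1,2)])
    fix xs assume "xs \<in> ?B"
    then show "measure (P i) {\<omega> \<in> space (P i). path 0 n \<omega> = xs \<and> E \<omega>} =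
      c * measure (P i) {\<omega> \<in> space (P i). path 0 n \<omega> = xs}"
      using assms(3)[of "\<lambda>k. xs ! k"] by (simp add: path_eq_iff)
  qed measurable
  then show ?thesis
    by (simp only: B conj_assoc[symmetric])
qed

text \<open>Two decompositions, one of the past and one of the future, reduce the claim to
  \<open>law_concat\<close> for a single pair of paths.\<close>

lemma markov_property:
  "measure (P i) {\<omega> \<in> space (P i). path 0 n \<omega> \<in> B \<and> Y n \<omega> = a \<and> path n m \<omega> \<in> C} =
    measure (P i) {\<omega> \<in> space (P i). path 0 n \<omega> \<in> B \<and> Y n \<omega> = a}
      * measure (P a) {\<omega> \<in> space (P a). path 0 m \<omega> \<in> C}"
proof (subst mult.commute, rule measure_prefix_decomp)
  fix x :: "nat \<Rightarrow> 'v" assume x: "x n = a"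
  let ?C = "{ys \<in> C. length ys = Suc m}"
  let ?E = "\<lambda>\<omega>. \<forall>k\<le>n. Y k \<omega> = x k"
  have C: "path l m \<omega> \<in> C \<longleftrightarrow> path l m \<omega> \<in> ?C" for l \<omega>
    by auto
  have "measure (P i) {\<omega> \<in> space (P i). path n m \<omega> \<in> ?C \<and> ?E \<omega>} =
      measure (P i) {\<omega> \<in> space (P i). ?E \<omega>} * measure (P a) {\<omega> \<in> space (P a). path 0 m \<omega> \<in> ?C}"
  proof (rule measure_countable_decomp[OF finite_P finite_P])
    fix ys assume "ys \<in> ?C"
    then show "measure (P i) {\<omega> \<in> space (P i). path n m \<omega> = ys \<and> ?E \<omega>} =
      measure (P i) {\<omega> \<in> space (P i). ?E \<omega>} * measure (P a) {\<omega> \<in> space (P a). path 0 m \<omega> = ys}"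
      using law_concat[of i n x m "\<lambda>k. ys ! k"] x by (simp add: path_eq_iff conj_commute)
  qed auto
  then show "measure (P i) {\<omega> \<in> space (P i). ?E \<omega> \<and> path n m \<omega> \<in> C} =
      measure (P a) {\<omega> \<in> space (P a). path 0 m \<omega> \<in> C} * measure (P i) {\<omega> \<in> space (P i). ?E \<omega>}"
    by (simp only: C mult.commute conj_commute)
qed auto

section \<open>Transition probabilities\<close>

definition trans_prob :: "nat \<Rightarrow> 'v \<Rightarrow> 'v \<Rightarrow> real" where
  "trans_prob n i j = measure (P i) {\<omega> \<in> space (P i). Y n \<omega> = j}"

lemma trans_prob_nonneg [simp]: "0 \<le> trans_prob n i j"
  by (simp add: trans_prob_def)

lemma trans_prob_0: "trans_prob 0 i j = (if i = j then 1 else 0)"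
  using law[of i 0 "\<lambda>_. j"] by (simp add: trans_prob_def eq_commute)

lemma AE_start: "AE \<omega> in P i. Y 0 \<omega> = i"
  using trans_prob_0[of i i] prob_space.AE_prob_1[OF prob_space_P, of i "{\<omega> \<in> space (P i). Y 0 \<omega> = i}"]
  by (simp add: trans_prob_def)

lemma trans_prob_1: "trans_prob (Suc 0) i j = p i j"
proof -
  have "trans_prob (Suc 0) i j
      = measure (P i) {\<omega> \<in> space (P i). \<forall>k\<le>Suc 0. Y k \<omega> = (if k = 0 then i else j)}"
    unfolding trans_prob_def
    by (rule finite_measure.finite_measure_eq_AE[OF finite_P])
      (use AE_start[of i] in \<open>auto simp: le_Suc_eq\<close>)
  then show ?thesis
    by (subst (asm) law) simp
qed

lemma trans_prob_markov:
  "measure (P i) {\<omega> \<in> space (P i). path 0 n \<omega> \<in> B \<and> Y n \<omega> = a \<and> Y (n + m) \<omega> = b} =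
    measure (P i) {\<omega> \<in> space (P i). path 0 n \<omega> \<in> B \<and> Y n \<omega> = a} * trans_prob m a b"
  using markov_property[of i n B a m "{ys. ys ! m = b}"] by (simp add: trans_prob_def)

lemma trans_prob_pair:
  "measure (P i) {\<omega> \<in> space (P i). Y n \<omega> = a \<and> Y (n + m) \<omega> = b} = trans_prob n i a * trans_prob m a b"
  using trans_prob_markov[of i n UNIV] by (simp add: trans_prob_def)

lemma trans_prob_step:
  "measure (P i) {\<omega> \<in> space (P i). Y n \<omega> = a \<and> Y (Suc n) \<omega> = b} = trans_prob n i a * p a b"
  using trans_prob_pair[of i n a 1 b] by (simp add: trans_prob_1)

text \<open>There are only countably many pairs of sites, so the null events of the forbidden
  transitions add up to a null event. Path arguments may then assume that every jump is a permitted
  one.\<close>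

lemma AE_step: "AE \<omega> in P i. p (Y n \<omega>) (Y (Suc n) \<omega>) \<noteq> 0"
proof -
  have "AE \<omega> in P i. \<not> (Y n \<omega> = a \<and> Y (Suc n) \<omega> = b)" if "p a b = 0" for a b
    using trans_prob_step[of i n a b] that
    by (intro AE_I[where N = "{\<omega> \<in> space (P i). Y n \<omega> = a \<and> Y (Suc n) \<omega> = b}"])
      (auto simp: emeasure_P)
  then have "AE \<omega> in P i. \<forall>a b. p a b = 0 \<longrightarrow> \<not> (Y n \<omega> = a \<and> Y (Suc n) \<omega> = b)"
    by (subst AE_all_countable, intro allI, subst AE_all_countable) auto
  then show ?thesis
    by eventually_elim auto
qed

lemma AE_steps: "AE \<omega> in P i. \<forall>n. p (Y n \<omega>) (Y (Suc n) \<omega>) \<noteq> 0"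
  by (subst AE_all_countable) (simp add: AE_step)

lemma trans_prob_decomp:
  assumes "finite A" and "\<And>\<omega>. \<lbrakk>\<forall>n. p (Y n \<omega>) (Y (Suc n) \<omega>) \<noteq> 0; Y 0 \<omega> = i; Y n \<omega> = b\<rbrakk> \<Longrightarrow> Y k \<omega> \<in> A"
  shows "trans_prob n i b = (\<Sum>a\<in>A. measure (P i) {\<omega> \<in> space (P i). Y k \<omega> = a \<and> Y n \<omega> = b})"
proof -
  have "trans_prob n i b = measure (P i) (\<Union>a\<in>A. {\<omega> \<in> space (P i). Y k \<omega> = a \<and> Y n \<omega> = b})"
    unfolding trans_prob_def using AE_steps[of i] AE_start[of i] assms
    by (intro finite_measure.finite_measure_eq_AE[OF finite_P]) auto
  also have "\<dots> = (\<Sum>a\<in>A. measure (P i) {\<omega> \<in> space (P i). Y k \<omega> = a \<and> Y n \<omega> = b})"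
    using assms(1) by (intro finite_measure.finite_measure_finite_Union[OF finite_P])
      (auto simp: disjoint_family_on_def)
  finally show ?thesis .
qed

lemma trans_prob_forward:
  assumes "finite A" and "\<And>a. p a b \<noteq> 0 \<Longrightarrow> a \<in> A"
  shows "trans_prob (Suc n) i b = (\<Sum>a\<in>A. trans_prob n i a * p a b)"
  by (subst trans_prob_decomp[OF assms(1), of i "Suc n" b n])
    (auto simp: trans_prob_step intro: assms(2))

lemma trans_prob_backward:
  assumes "finite A" and "\<And>a. p i a \<noteq> 0 \<Longrightarrow> a \<in> A"
  shows "trans_prob (Suc n) i b = (\<Sum>a\<in>A. p i a * trans_prob n a b)"
proof -
  have "Y 1 \<omega> \<in> A" if "\<forall>n. p (Y n \<omega>) (Y (Suc n) \<omega>) \<noteq> 0" "Y 0 \<omega> = i" for \<omega>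
    using that(1)[rule_format, of 0] that(2) assms(2) by auto
  then have "trans_prob (Suc n) i b
      = (\<Sum>a\<in>A. measure (P i) {\<omega> \<in> space (P i). Y 1 \<omega> = a \<and> Y (Suc n) \<omega> = b})"
    by (rule trans_prob_decomp[OF assms(1)])
  then show ?thesis
    using trans_prob_pair[of i 1 _ n b] by (simp add: trans_prob_1)
qed

section \<open>First visits and the Green function\<close>

definition first_hit :: "nat \<Rightarrow> 'v \<Rightarrow> 'w \<Rightarrow> bool" where
  "first_hit k a \<omega> \<longleftrightarrow> Y k \<omega> = a \<and> (\<forall>l<k. Y l \<omega> \<noteq> a)"

lemma measurable_first_hit [measurable]: "Measurable.pred (P i) (first_hit k a)"
  unfolding first_hit_def by measurable

definition hit_prob :: "'v \<Rightarrow> 'v \<Rightarrow> real" where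
  "hit_prob i a = measure (P i) {\<omega> \<in> space (P i). \<exists>n. Y n \<omega> = a}"

lemma first_hit_ex: "Y n \<omega> = a \<Longrightarrow> \<exists>k\<le>n. first_hit k a \<omega>"
proof (intro exI conjI)
  assume a: "Y n \<omega> = a"
  show "(LEAST k. Y k \<omega> = a) \<le> n"
    using a by (rule Least_le)
  show "first_hit (LEAST k. Y k \<omega> = a) a \<omega>"
    unfolding first_hit_def using LeastI[of "\<lambda>k. Y k \<omega> = a", OF a]
    by (auto dest: not_less_Least)
qed

lemma first_hit_unique: "first_hit k a \<omega> \<Longrightarrow> first_hit l a \<omega> \<Longrightarrow> k = l"
  unfolding first_hit_def by (cases k l rule: linorder_cases) auto

lemma hit_prob_sum:
  "ennreal (hit_prob i a) = (\<Sum>k. ennreal (measure (P i) {\<omega> \<in> space (P i). first_hit k a \<omega>}))"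
proof -
  have "(\<exists>n. Y n \<omega> = a) \<longleftrightarrow> (\<exists>k. first_hit k a \<omega>)" for \<omega>
    using first_hit_ex[of _ \<omega> a] by (auto simp: first_hit_def)
  then have "{\<omega> \<in> space (P i). \<exists>n. Y n \<omega> = a} = (\<Union>k. {\<omega> \<in> space (P i). first_hit k a \<omega>})"
    by auto
  then have "ennreal (hit_prob i a) = emeasure (P i) (\<Union>k. {\<omega> \<in> space (P i). first_hit k a \<omega>})"
    by (simp add: hit_prob_def emeasure_P)
  also have "\<dots> = (\<Sum>k. emeasure (P i) {\<omega> \<in> space (P i). first_hit k a \<omega>})"
    by (rule suminf_emeasure[symmetric])
      (auto simp: disjoint_family_on_def dest: first_hit_unique)
  finally show ?thesis
    by (simp add: emeasure_P)
qed

definition green :: "'v \<Rightarrow> 'v \<Rightarrow> ennreal" where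
  "green i j = (\<Sum>n. ennreal (trans_prob n i j))"

text \<open>The hypothesis says that \<open>a\<close> separates \<open>i\<close> from
  \<open>j\<close>. Paths are cut at the first visit to \<open>a\<close>, and summing over the final
  time gives a Cauchy product of the first-visit distribution with the transition probabilities from
  \<open>a\<close>.\<close>

lemma green_first_hit:
  assumes sep: "\<And>\<omega> n. \<lbrakk>\<forall>n. p (Y n \<omega>) (Y (Suc n) \<omega>) \<noteq> 0; Y 0 \<omega> = i; Y n \<omega> = j\<rbrakk> \<Longrightarrow> \<exists>k\<le>n. Y k \<omega> = a"
  shows "green i j = ennreal (hit_prob i a) * green a j"
proof -
  have "trans_prob n i j =
      (\<Sum>k\<le>n. measure (P i) {\<omega> \<in> space (P i). first_hit k a \<omega>} * trans_prob (n - k) a j)" for n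
  proof -
    have hit: "\<exists>k\<le>n. first_hit k a \<omega>"
      if h: "\<forall>n. p (Y n \<omega>) (Y (Suc n) \<omega>) \<noteq> 0" "Y 0 \<omega> = i" "Y n \<omega> = j" for \<omega>
    proof -
      obtain m where "m \<le> n" "Y m \<omega> = a"
        using sep[OF h] by blast
      then show ?thesis
        using first_hit_ex[of m \<omega> a] order_trans by blast
    qed
    have "AE \<omega> in P i. \<omega> \<in> {\<omega> \<in> space (P i). Y n \<omega> = j} \<longleftrightarrow>
        \<omega> \<in> (\<Union>k\<le>n. {\<omega> \<in> space (P i). first_hit k a \<omega> \<and> Y n \<omega> = j})"
      using AE_steps[of i] AE_start[of i]
    proof eventually_elim
      case (elim \<omega>)
      then show ?case
        using hit[of \<omega>] by auto
    qed
    then have "trans_prob n i j = measure (P i) (\<Union>k\<le>n. {\<omega> \<in> space (P i). first_hit k a \<omega> \<and> Y n \<omega> = j})"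
      unfolding trans_prob_def by (rule finite_measure.finite_measure_eq_AE[OF finite_P]) auto
    also have "\<dots> = (\<Sum>k\<le>n. measure (P i) {\<omega> \<in> space (P i). first_hit k a \<omega> \<and> Y n \<omega> = j})"
      by (intro finite_measure.finite_measure_finite_Union[OF finite_P])
        (auto simp: disjoint_family_on_def dest: first_hit_unique)
    also have "\<dots> =
      (\<Sum>k\<le>n. measure (P i) {\<omega> \<in> space (P i). first_hit k a \<omega>} * trans_prob (n - k) a j)"
    proof (rule sum.cong[OF refl])
      fix k assume "k \<in> {..n}"
      \<comment> \<open>A first visit at time \<open>k\<close> is decided by the prefix up to
        \<open>k\<close>, which is what the Markov property requires.\<close>
      let ?B = "{xs. xs ! k = a \<and> (\<forall>l<k. xs ! l \<noteq> a)}"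
      have *: "path 0 k \<omega> \<in> ?B \<and> Y k \<omega> = a \<longleftrightarrow> first_hit k a \<omega>" for \<omega>
        by (auto simp: first_hit_def)
      show "measure (P i) {\<omega> \<in> space (P i). first_hit k a \<omega> \<and> Y n \<omega> = j}
          = measure (P i) {\<omega> \<in> space (P i). first_hit k a \<omega>} * trans_prob (n - k) a j"
        using trans_prob_markov[of i k ?B a "n - k" j] \<open>k \<in> {..n}\<close>
        by (simp only: conj_assoc[symmetric] *) simp
    qed
    finally show ?thesis .
  qed
  then have "green i j = (\<Sum>n. \<Sum>k\<le>n. ennreal (measure (P i) {\<omega> \<in> space (P i). first_hit k a \<omega>})
      * ennreal (trans_prob (n - k) a j))"
    unfolding green_def by (simp add: ennreal_mult sum_nonneg flip: sum_ennreal)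
  then show ?thesis
    using suminf_ennreal_triangle[of "\<lambda>k. ennreal (measure (P i) {\<omega> \<in> space (P i). first_hit k a \<omega>})"
        "\<lambda>n. ennreal (trans_prob n a j)"]
    by (simp add: hit_prob_sum green_def)
qed

lemma green_hit: "green i j = ennreal (hit_prob i j) * green j j"
  by (rule green_first_hit) auto

lemma green_backward:
  assumes "finite A" and "\<And>a. p i a \<noteq> 0 \<Longrightarrow> a \<in> A"
  shows "green i b = (if i = b then 1 else 0) + (\<Sum>a\<in>A. ennreal (p i a) * green a b)"
proof -
  have "green i b = (\<Sum>n. ennreal (trans_prob (Suc n) i b)) + ennreal (trans_prob 0 i b)"
    unfolding green_def by (subst suminf_offset[of _ 1]) auto
  also have "(\<Sum>n. ennreal (trans_prob (Suc n) i b))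
      = (\<Sum>n. \<Sum>a\<in>A. ennreal (p i a) * ennreal (trans_prob n a b))"
    by (subst trans_prob_backward[OF assms])
      (simp_all add: p_nonneg ennreal_mult flip: sum_ennreal)
  also have "\<dots> = (\<Sum>a\<in>A. \<Sum>n. ennreal (p i a) * ennreal (trans_prob n a b))"
    by (rule suminf_sum) auto
  finally show ?thesis
    by (simp add: trans_prob_0 green_def ennreal_suminf_cmult add.commute)
qed

section \<open>Finiteness of the expected number of visits\<close>

definition no_return :: "nat \<Rightarrow> 'v \<Rightarrow> real" where
  "no_return m a = measure (P a) {\<omega> \<in> space (P a). \<forall>l\<in>{1..m}. Y l \<omega> \<noteq> a}"

lemma no_return_markov:
  "measure (P i) {\<omega> \<in> space (P i). Y n \<omega> = a \<and> (\<forall>l\<in>{1..m}. Y (n + l) \<omega> \<noteq> a)}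
    = trans_prob n i a * no_return m a"
  using markov_property[of i n UNIV a m "{ys. \<forall>l\<in>{1..m}. ys ! l \<noteq> a}"]
  by (simp add: trans_prob_def no_return_def)

text \<open>Some time \<open>n\<close> is the time of the last visit with probability \<open>e > 0\<close>, so that for every \<open>N\<close> the
  first \<open>N\<close> steps avoid a return with probability at least \<open>e\<close>. The events of a visit before time \<open>N\<close>
  followed by \<open>N\<close> steps without return are disjoint, hence the expected number of visits is at most
  \<open>1 / e\<close>.\<close>

lemma green_finite:
  assumes last: "AE \<omega> in P i. \<exists>n. Y n \<omega> = i \<and> (\<forall>l>n. Y l \<omega> \<noteq> i)"
  shows "green i i < \<top>"
proof -
  let ?L = "\<lambda>n. {\<omega> \<in> space (P i). Y n \<omega> = i \<and> (\<forall>l>n. Y l \<omega> \<noteq> i)}"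
  interpret prob_space "P i" by (rule prob_space_P)
  obtain n where n: "measure (P i) (?L n) \<noteq> 0"
  proof (rule ccontr)
    assume "\<not> thesis"
    then have "AE \<omega> in P i. \<omega> \<notin> ?L n" for n
      using that by (intro AE_I[where N = "?L n"]) (auto simp: emeasure_P)
    then have "AE \<omega> in P i. \<forall>n. \<omega> \<notin> ?L n"
      by (subst AE_all_countable) auto
    with last have "AE \<omega> in P i. False"
      using AE_space by eventually_elim auto
    then show False
      by simp
  qed
  define e where "e = measure (P i) (?L n)"
  have e: "0 < e"
    using n by (simp add: e_def zero_less_measure_iff)
  have e_le: "e \<le> no_return m i" for m
  proof -
    have "e \<le> measure (P i) {\<omega> \<in> space (P i). Y n \<omega> = i \<and> (\<forall>l\<in>{1..m}. Y (n + l) \<omega> \<noteq> i)}"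
      unfolding e_def by (intro finite_measure_mono) auto
    also have "\<dots> \<le> no_return m i"
      unfolding no_return_markov using prob_le_1
      by (intro mult_left_le_one_le) (auto simp: trans_prob_def no_return_def)
    finally show ?thesis .
  qed
  have "(\<Sum>n<N. trans_prob n i i) \<le> 1 / e" for N
  proof -
    let ?A = "\<lambda>n. {\<omega> \<in> space (P i). Y n \<omega> = i \<and> (\<forall>l\<in>{1..N}. Y (n + l) \<omega> \<noteq> i)}"
    have "disjoint_family_on ?A {..<N}"
      unfolding disjoint_family_on_def
    proof (intro ballI impI)
      fix m n assume "m \<in> {..<N}" "n \<in> {..<N}" "m \<noteq> n"
      then show "?A m \<inter> ?A n = {}"
      proof (induction m n rule: linorder_wlog)
        case (le m n)
        then show ?case by (auto dest!: bspec[of _ _ "n - m"])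
      qed auto
    qed
    then have "(\<Sum>n<N. measure (P i) (?A n)) = measure (P i) (\<Union>n<N. ?A n)"
      by (intro finite_measure_finite_Union[symmetric]) auto
    also have "\<dots> \<le> 1"
      by (rule prob_le_1)
    finally have "(\<Sum>n<N. trans_prob n i i) * no_return N i \<le> 1"
      unfolding no_return_markov by (simp add: sum_distrib_right)
    moreover have "(\<Sum>n<N. trans_prob n i i) * e \<le> (\<Sum>n<N. trans_prob n i i) * no_return N i"
      by (intro mult_left_mono e_le sum_nonneg) simp
    ultimately show ?thesis
      using e by (simp add: field_simps)
  qed
  then have "green i i \<le> ennreal (1 / e)"
    unfolding green_def
    by (intro suminf_le_const) (auto simp: sum_ennreal intro!: ennreal_leI summableI)
  then show ?thesis
    by (rule le_less_trans) simp
qed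

end

section \<open>Minimal chains and their holding times\<close>

locale hold_chain =
  fixes Q :: "'v :: countable \<Rightarrow> 'v \<Rightarrow> real" and P :: "'v \<Rightarrow> 'w measure"
    and Y :: "nat \<Rightarrow> 'w \<Rightarrow> 'v" and S :: "nat \<Rightarrow> 'w \<Rightarrow> real"
  assumes chain: "minimal_chain Q P Y S"
    and Q_off: "i \<noteq> j \<Longrightarrow> 0 \<le> Q i j" and Q_diag: "Q i i < 0"
begin

lemma chain_law:
  assumes "\<And>k. 0 \<le> t k"
  shows "measure (P i) {\<omega> \<in> space (P i). \<forall>k\<le>n. Y k \<omega> = x k \<and> t k < S k \<omega>} =
    (if x 0 = i then 1 else 0) * (\<Prod>k<n. jump_prob Q (x k) (x (Suc k)))
      * (\<Prod>k\<le>n. exp (Q (x k) (x k) * t k))"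
  using chain assms unfolding minimal_chain_def by blast

lemma measurable_S [measurable]: "S n \<in> borel_measurable (P i)"
  using chain unfolding minimal_chain_def by blast

lemma S_pos: "\<omega> \<in> space (P i) \<Longrightarrow> 0 < S n \<omega>"
  using chain unfolding minimal_chain_def by blast

sublocale markov_family P Y "jump_prob Q"
proof (rule markov_family.intro)
  show "prob_space (P i)" for i
    using chain unfolding minimal_chain_def by blast
  show "Y n \<in> P i \<rightarrow>\<^sub>M count_space UNIV" for i n
    using chain unfolding minimal_chain_def by blast
  show "0 \<le> jump_prob Q i j" for i j
    using Q_off[of i j] Q_diag[of i]
    by (auto simp: jump_prob_def divide_nonneg_neg)
  fix i n and x :: "nat \<Rightarrow> 'v"
  \<comment> \<open>Holding times are positive, so thresholds 0 in the joint law leave the law of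
    the jump chain.\<close>
  have "{\<omega> \<in> space (P i). \<forall>k\<le>n. Y k \<omega> = x k} = {\<omega> \<in> space (P i). \<forall>k\<le>n. Y k \<omega> = x k \<and> 0 < S k \<omega>}"
    using S_pos by auto
  then show "measure (P i) {\<omega> \<in> space (P i). \<forall>k\<le>n. Y k \<omega> = x k} =
    (if x 0 = i then 1 else 0) * (\<Prod>k<n. jump_prob Q (x k) (x (Suc k)))"
    using chain_law[of "\<lambda>_. 0" i n x] by simp
qed

section \<open>Jump times, lifetime and limits of the path\<close>

abbreviation X :: "real \<Rightarrow> 'w \<Rightarrow> 'v option" where "X \<equiv> chain_path Y S"

text \<open>The sum stops before \<open>n\<close>, so that \<open>Y n\<close> occupies the half-open
  interval from \<open>arrival n\<close> to \<open>arrival (Suc n)\<close>.\<close>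

definition arrival :: "nat \<Rightarrow> 'w \<Rightarrow> real" where
  "arrival n \<omega> = (\<Sum>k<n. S k \<omega>)"

context
  fixes \<omega> :: 'w and i :: 'v
  assumes \<omega>: "\<omega> \<in> space (P i)"
begin

lemma arrival_mono: "m \<le> n \<Longrightarrow> arrival m \<omega> \<le> arrival n \<omega>"
  unfolding arrival_def using S_pos[OF \<omega>] by (intro sum_mono2) (auto intro: less_imp_le)

lemma arrival_less: "arrival n \<omega> < arrival (Suc n) \<omega>"
  using S_pos[OF \<omega>, of n] by (simp add: arrival_def)

lemma arrival_nonneg: "0 \<le> arrival n \<omega>"
  using arrival_mono[of 0 n] by (simp add: arrival_def)

lemma chain_path_eq:
  assumes "arrival n \<omega> \<le> t" "t < arrival (Suc n) \<omega>"
  shows "X t \<omega> = Some (Y n \<omega>)"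
proof -
  have "(LEAST m. t < (\<Sum>k\<le>m. S k \<omega>)) = n"
  proof (rule Least_equality)
    show "t < (\<Sum>k\<le>n. S k \<omega>)"
      using assms by (simp add: arrival_def lessThan_Suc_atMost)
    fix m assume "t < (\<Sum>k\<le>m. S k \<omega>)"
    then have "t < arrival (Suc m) \<omega>"
      by (simp add: arrival_def lessThan_Suc_atMost)
    then show "n \<le> m"
      using arrival_mono[of "Suc m" n] assms by (cases "n \<le> m") auto
  qed
  moreover have "t < (\<Sum>k\<le>n. S k \<omega>)" "0 \<le> t"
    using assms arrival_nonneg[of n] by (auto simp: arrival_def lessThan_Suc_atMost)
  ultimately show ?thesis
    unfolding chain_path_def by auto
qed

lemma chain_path_defined:
  assumes "0 \<le> t" "t < arrival n \<omega>"
  obtains m where "m < n" "arrival m \<omega> \<le> t" "t < arrival (Suc m) \<omega>"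
proof -
  define m where "m = (LEAST m. t < arrival (Suc m) \<omega>)"
  obtain k where k: "n = Suc k"
    using assms by (cases n) (auto simp: arrival_def)
  have m: "t < arrival (Suc m) \<omega>" "m \<le> k"
    using assms(2) unfolding m_def k by (rule LeastI, rule Least_le)
  moreover have "arrival m \<omega> \<le> t"
  proof (cases m)
    case (Suc l)
    then show ?thesis
      using not_less_Least[of l "\<lambda>m. t < arrival (Suc m) \<omega>"] by (simp add: m_def)
  qed (use assms in \<open>simp add: arrival_def\<close>)
  ultimately show ?thesis
    using that[of m] k by simp
qed

lemma chain_path_SomeE:
  assumes "X t \<omega> = Some j"
  obtains n where "arrival n \<omega> \<le> t" "t < arrival (Suc n) \<omega>" "Y n \<omega> = j"
proof -
  from assms obtain n where "0 \<le> t" "t < arrival (Suc n) \<omega>"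
    unfolding chain_path_def arrival_def lessThan_Suc_atMost by (metis option.distinct(1))
  then obtain m where m: "arrival m \<omega> \<le> t" "t < arrival (Suc m) \<omega>"
    by (rule chain_path_defined)
  then show ?thesis
    using assms chain_path_eq[OF m] that by simp
qed

lemma chain_path_arrival: "X (arrival n \<omega>) \<omega> = Some (Y n \<omega>)"
  by (rule chain_path_eq) (auto simp: arrival_less)

lemma arrival_less_lifetime: "ennreal (arrival n \<omega>) < lifetime X \<omega>"
proof -
  have "ennreal (arrival (Suc n) \<omega>) \<le> lifetime X \<omega>"
    unfolding lifetime_def using arrival_nonneg chain_path_arrival by (intro Sup_upper) auto
  moreover have "ennreal (arrival n \<omega>) < ennreal (arrival (Suc n) \<omega>)"
    using arrival_less[of n] arrival_nonneg[of n] by (simp add: ennreal_less_iff)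
  ultimately show ?thesis
    by (rule less_le_trans[rotated])
qed

text \<open>The lifetime is the supremum of the jump times and exceeds each of them, because another
  holding period always follows.\<close>

lemma less_lifetime_iff:
  assumes "0 \<le> t"
  shows "ennreal t < lifetime X \<omega> \<longleftrightarrow> (\<exists>n. t < arrival n \<omega>)"
proof
  assume "ennreal t < lifetime X \<omega>"
  then obtain s j where s: "0 \<le> s" "X s \<omega> = Some j" "t < s"
    using assms by (auto simp: lifetime_def less_Sup_iff ennreal_less_iff)
  from this(2) obtain n where "s < arrival (Suc n) \<omega>"
    by (rule chain_path_SomeE)
  with s(3) have "t < arrival (Suc n) \<omega>"
    by (rule less_trans)
  then show "\<exists>n. t < arrival n \<omega>" ..
next
  assume "\<exists>n. t < arrival n \<omega>"
  then obtain n where "t < arrival n \<omega>" ..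
  then have "ennreal t < ennreal (arrival n \<omega>)"
    using assms by (simp add: ennreal_less_iff)
  then show "ennreal t < lifetime X \<omega>"
    using arrival_less_lifetime[of n] by (rule less_trans)
qed

text \<open>Each visited site is occupied from its arrival time on for a positive time, so hitting
  in continuous time and in the jump chain agree.\<close>

lemma hitting_time_finite: "hitting_time X j \<omega> < \<top> \<longleftrightarrow> (\<exists>n. Y n \<omega> = j)"
proof
  assume "hitting_time X j \<omega> < \<top>"
  then obtain t where "X t \<omega> = Some j"
    by (auto simp: hitting_time_def Inf_less_iff)
  then show "\<exists>n. Y n \<omega> = j"
    by (rule chain_path_SomeE) auto
next
  assume "\<exists>n. Y n \<omega> = j"
  then obtain n where "Y n \<omega> = j" ..
  then have "X (arrival n \<omega>) \<omega> = Some j"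
    by (simp add: chain_path_arrival)
  then show "hitting_time X j \<omega> < \<top>"
    using arrival_nonneg[of n]
    by (auto simp: hitting_time_def Inf_less_iff intro!: exI[of _ "ennreal (arrival n \<omega>)"])
qed

text \<open>The jump times tend to the lifetime from below, whether it is finite or not, and the
  path sampled at them is the jump chain.\<close>

lemma exits_at_limit:
  assumes "exits_at T r X \<omega> \<xi>"
  shows "filterlim (\<lambda>n. Y n \<omega>) (toward T r \<xi>) sequentially"
proof -
  define F where "F = (if lifetime X \<omega> = \<top> then at_top else at_left (enn2real (lifetime X \<omega>)))"
  have ev: "\<forall>\<^sub>F n in sequentially. t < arrival n \<omega>" if t: "0 \<le> t" "ennreal t < lifetime X \<omega>" for t
  proof -
    obtain m where "t < arrival m \<omega>"
      using t less_lifetime_iff by auto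
    then show ?thesis
      using arrival_mono less_le_trans unfolding eventually_sequentially by blast
  qed
  have "filterlim (\<lambda>n. arrival n \<omega>) F sequentially"
  proof (cases "lifetime X \<omega> = \<top>")
    case True
    show ?thesis
      unfolding F_def if_P[OF True]
    proof (rule filterlim_at_top_dense[THEN iffD2], rule allI)
      fix Z :: real
      show "\<forall>\<^sub>F n in sequentially. Z < arrival n \<omega>"
        using ev[of "max 0 Z"] True by (auto elim: eventually_mono)
    qed
  next
    case False
    define z where "z = enn2real (lifetime X \<omega>)"
    have z: "lifetime X \<omega> = ennreal z" "0 \<le> z"
      using False by (simp_all add: z_def less_top)
    have lt: "arrival n \<omega> < z" for n
      using arrival_less_lifetime[of n] arrival_nonneg[of n] by (simp add: z ennreal_less_iff)
    have "(\<lambda>n. arrival n \<omega>) \<longlonglongrightarrow> z"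
    proof (rule order_tendstoI)
      fix t assume "t < z"
      then have "\<forall>\<^sub>F n in sequentially. max 0 t < arrival n \<omega>"
        using lt[of 0] arrival_nonneg[of 0] by (intro ev) (auto simp: z intro!: ennreal_lessI)
      then show "\<forall>\<^sub>F n in sequentially. t < arrival n \<omega>"
        by (auto elim: eventually_mono)
    qed (use lt less_trans in \<open>auto intro!: always_eventually\<close>)
    then have "filterlim (\<lambda>n. arrival n \<omega>) (at_left z) sequentially"
      using lt by (auto simp: filterlim_at intro!: always_eventually less_imp_neq)
    then show ?thesis
      using False by (simp add: F_def z_def)
  qed
  moreover have "filterlim (\<lambda>t. the (X t \<omega>)) (toward T r \<xi>) F"
    using assms by (simp add: exits_at_def F_def)
  ultimately have "filterlim (\<lambda>n. the (X (arrival n \<omega>) \<omega>)) (toward T r \<xi>) sequentially"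
    by (rule filterlim_compose[rotated])
  then show ?thesis
    by (simp add: chain_path_arrival)
qed

end

section \<open>Occupation times\<close>

definition occ :: "'v \<Rightarrow> nat \<Rightarrow> 'w \<Rightarrow> real" where
  "occ j n \<omega> = (if Y n \<omega> = j then S n \<omega> else 0)"

lemma measurable_occ [measurable]: "occ j n \<in> borel_measurable (P i)"
  unfolding occ_def by measurable

lemma occ_nonneg: "\<omega> \<in> space (P i) \<Longrightarrow> 0 \<le> occ j n \<omega>"
  using S_pos[of \<omega> i n] by (simp add: occ_def)

lemma emeasure_holding_interval:
  assumes "\<omega> \<in> space (P i)"
  shows "emeasure lborel (if Y n \<omega> = j then {arrival n \<omega>..<arrival (Suc n) \<omega>} else {})
    = ennreal (occ j n \<omega>)"
  using S_pos[OF assms, of n] by (simp add: occ_def arrival_def)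

lemma holding_intervals_disjoint:
  assumes "\<omega> \<in> space (P i)"
  shows "disjoint_family (\<lambda>n. if Y n \<omega> = j then {arrival n \<omega>..<arrival (Suc n) \<omega>} else {})"
  unfolding disjoint_family_on_def
proof (intro ballI impI)
  fix m n :: nat assume "m \<noteq> n"
  then show "(if Y m \<omega> = j then {arrival m \<omega>..<arrival (Suc m) \<omega>} else {}) \<inter>
      (if Y n \<omega> = j then {arrival n \<omega>..<arrival (Suc n) \<omega>} else {}) = {}"
  proof (induction m n rule: linorder_wlog)
    case (le m n)
    then have "arrival (Suc m) \<omega> \<le> arrival n \<omega>"
      by (intro arrival_mono[OF assms]) simp
    then show ?case by auto
  qed auto
qed

lemma occupation_total:
  assumes \<omega>: "\<omega> \<in> space (P i)"
  shows "(\<integral>\<^sup>+t. indicator {t. 0 \<le> t \<and> ennreal t < lifetime X \<omega> \<and> X t \<omega> = Some j} t \<partial>lborel)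
    = (\<Sum>n. ennreal (occ j n \<omega>))"
proof -
  let ?I = "\<lambda>n. if Y n \<omega> = j then {arrival n \<omega>..<arrival (Suc n) \<omega>} else {}"
  have "{t. 0 \<le> t \<and> ennreal t < lifetime X \<omega> \<and> X t \<omega> = Some j} = (\<Union>n. ?I n)"
  proof (intro set_eqI iffI)
    fix t assume "t \<in> {t. 0 \<le> t \<and> ennreal t < lifetime X \<omega> \<and> X t \<omega> = Some j}"
    then show "t \<in> (\<Union>n. ?I n)"
      using chain_path_SomeE[OF \<omega>, of t j] by (auto split: if_splits)
  next
    fix t assume "t \<in> (\<Union>n. ?I n)"
    then obtain n where n: "Y n \<omega> = j" "arrival n \<omega> \<le> t" "t < arrival (Suc n) \<omega>"
      by (auto split: if_splits)
    then show "t \<in> {t. 0 \<le> t \<and> ennreal t < lifetime X \<omega> \<and> X t \<omega> = Some j}"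
      using arrival_nonneg[OF \<omega>, of n] less_lifetime_iff[OF \<omega>, of t] chain_path_eq[OF \<omega> n(2,3)]
      by auto
  qed
  moreover have "emeasure lborel (\<Union>n. ?I n) = (\<Sum>n. emeasure lborel (?I n))"
    by (rule suminf_emeasure[symmetric]) (auto intro: holding_intervals_disjoint[OF \<omega>])
  ultimately show ?thesis
    by (simp add: emeasure_holding_interval[OF \<omega>])
qed

lemma holding_law:
  assumes "0 \<le> t"
  shows "measure (P i) {\<omega> \<in> space (P i). Y n \<omega> = j \<and> t < S n \<omega>} = exp (Q j j * t) * trans_prob n i j"
proof -
  have "measure (P i) {\<omega> \<in> space (P i). path 0 n \<omega> \<in> UNIV \<and> Y n \<omega> = j \<and> t < S n \<omega>} =
    exp (Q j j * t) * measure (P i) {\<omega> \<in> space (P i). path 0 n \<omega> \<in> UNIV \<and> Y n \<omega> = j}"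
  proof (rule measure_prefix_decomp)
    fix x :: "nat \<Rightarrow> 'v" assume x: "x n = j"
    \<comment> \<open>Only the last holding time is constrained, so a single exponential factor
      survives in the joint law.\<close>
    let ?t = "\<lambda>k. if k = n then t else 0"
    have "{\<omega> \<in> space (P i). (\<forall>k\<le>n. Y k \<omega> = x k) \<and> t < S n \<omega>}
        = {\<omega> \<in> space (P i). \<forall>k\<le>n. Y k \<omega> = x k \<and> ?t k < S k \<omega>}"
      using S_pos by auto
    moreover have "(\<Prod>k\<le>n. exp (Q (x k) (x k) * ?t k)) = exp (Q j j * t)"
      using x by (simp add: if_distrib[of "\<lambda>t. exp (_ * t)"] prod.delta if_distrib cong: if_cong)
    ultimately show "measure (P i) {\<omega> \<in> space (P i). (\<forall>k\<le>n. Y k \<omega> = x k) \<and> t < S n \<omega>} =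
      exp (Q j j * t) * measure (P i) {\<omega> \<in> space (P i). \<forall>k\<le>n. Y k \<omega> = x k}"
      using chain_law[of ?t i n x] assms by (simp add: law)
  qed auto
  then show ?thesis
    by (simp add: trans_prob_def)
qed

text \<open>Layer-cake formula: Tonelli turns the mean holding time on \<open>Y n = j\<close> into
  the integral over \<open>t\<close> of the probability of \<open>t < S n\<close> there, an
  exponential by \<open>holding_law\<close>.\<close>

lemma nn_integral_occ: "(\<integral>\<^sup>+\<omega>. ennreal (occ j n \<omega>) \<partial>P i) = ennreal (trans_prob n i j / (- Q j j))"
proof -
  interpret prob_space "P i" by (rule prob_space_P)
  interpret pair_sigma_finite "P i" lborel ..
  let ?f = "\<lambda>\<omega> t. indicator {t. 0 \<le> t \<and> t < S n \<omega> \<and> Y n \<omega> = j} t :: ennreal"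
  have "(\<integral>\<^sup>+\<omega>. ennreal (occ j n \<omega>) \<partial>P i) = (\<integral>\<^sup>+\<omega>. \<integral>\<^sup>+t. ?f \<omega> t \<partial>lborel \<partial>P i)"
  proof (rule nn_integral_cong)
    fix \<omega> assume "\<omega> \<in> space (P i)"
    then have "0 < S n \<omega>" by (rule S_pos)
    moreover have "{t. 0 \<le> t \<and> t < S n \<omega> \<and> Y n \<omega> = j} = (if Y n \<omega> = j then {0..<S n \<omega>} else {})"
      by auto
    ultimately show "ennreal (occ j n \<omega>) = (\<integral>\<^sup>+t. ?f \<omega> t \<partial>lborel)"
      by (simp add: occ_def)
  qed
  also have "\<dots> = (\<integral>\<^sup>+t. \<integral>\<^sup>+\<omega>. ?f \<omega> t \<partial>P i \<partial>lborel)"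
    by (rule Fubini'[symmetric]) (unfold indicator_def, simp, measurable)
  also have "\<dots> = (\<integral>\<^sup>+t. ennreal (trans_prob n i j) * (ennreal (exp (Q j j * t)) * indicator {0..} t) \<partial>lborel)"
  proof (rule nn_integral_cong)
    fix t :: real
    have "(\<integral>\<^sup>+\<omega>. ?f \<omega> t \<partial>P i)
        = (\<integral>\<^sup>+\<omega>. indicator {\<omega> \<in> space (P i). Y n \<omega> = j \<and> t < S n \<omega>} \<omega> * indicator {0..} t \<partial>P i)"
      by (rule nn_integral_cong) (auto simp: indicator_def)
    also have "\<dots> = emeasure (P i) {\<omega> \<in> space (P i). Y n \<omega> = j \<and> t < S n \<omega>} * indicator {0..} t"
      by (subst nn_integral_multc) auto
    also have "\<dots> = ennreal (trans_prob n i j) * (ennreal (exp (Q j j * t)) * indicator {0..} t)"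
      using holding_law[of t i n j]
      by (auto simp: indicator_def emeasure_P ennreal_mult mult.commute)
    finally show "(\<integral>\<^sup>+\<omega>. ?f \<omega> t \<partial>P i) =
      ennreal (trans_prob n i j) * (ennreal (exp (Q j j * t)) * indicator {0..} t)" .
  qed
  also have "\<dots> = ennreal (trans_prob n i j) * (\<integral>\<^sup>+t. ennreal (exp (Q j j * t)) * indicator {0..} t \<partial>lborel)"
    by (rule nn_integral_cmult) auto
  also have "(\<integral>\<^sup>+t. ennreal (exp (Q j j * t)) * indicator {0..} t \<partial>lborel)
      = ennreal (0 - exp (Q j j * 0) / Q j j)"
  proof (rule nn_integral_FTC_atLeast)
    show "((\<lambda>t. exp (Q j j * t) / Q j j) has_real_derivative exp (Q j j * t)) (at t)" for t
      using Q_diag[of j] by (auto intro!: derivative_eq_intros)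
    have "filterlim (\<lambda>t. Q j j * t) at_bot at_top"
      using Q_diag[of j] by (intro filterlim_tendsto_neg_mult_at_bot[OF tendsto_const _ filterlim_ident])
    then have "((\<lambda>t. exp (Q j j * t)) \<longlongrightarrow> 0) at_top"
      by (rule filterlim_compose[OF exp_at_bot])
    then show "((\<lambda>t. exp (Q j j * t) / Q j j) \<longlongrightarrow> 0) at_top"
      using tendsto_divide[OF _ tendsto_const, of _ 0 at_top "Q j j"] Q_diag[of j] by force
  qed auto
  finally show ?thesis
    using Q_diag[of j] by (simp add: ennreal_mult[symmetric] divide_le_0_iff)
qed

lemma potential_eq_sum: "potential P X i j = (\<Sum>n. \<integral>\<^sup>+\<omega>. ennreal (occ j n \<omega>) \<partial>P i)"
proof -
  have "potential P X i j = (\<integral>\<^sup>+\<omega>. (\<Sum>n. ennreal (occ j n \<omega>)) \<partial>P i)"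
    unfolding potential_def by (rule nn_integral_cong) (rule occupation_total)
  also have "\<dots> = (\<Sum>n. \<integral>\<^sup>+\<omega>. ennreal (occ j n \<omega>) \<partial>P i)"
    by (rule nn_integral_suminf) measurable
  finally show ?thesis .
qed

lemma potential_green: "potential P X i j = green i j / ennreal (- Q j j)"
proof -
  have "ennreal (trans_prob n i j / (- Q j j)) = ennreal (trans_prob n i j) / ennreal (- Q j j)" for n
    using Q_diag[of j] by (intro divide_ennreal[symmetric]) auto
  then show ?thesis
    unfolding potential_eq_sum nn_integral_occ green_def
    by (simp only: divide_ennreal_def ennreal_suminf_multc)
qed

section \<open>Survival up to the lifetime\<close>

lemma AE_occ_summable:
  assumes "potential P X i j < \<top>"
  shows "AE \<omega> in P i. (\<Sum>n. ennreal (occ j n \<omega>)) < \<top>"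
proof -
  have "(\<integral>\<^sup>+\<omega>. (\<Sum>n. ennreal (occ j n \<omega>)) \<partial>P i) = potential P X i j"
    unfolding potential_def
    by (rule nn_integral_cong) (rule occupation_total[symmetric])
  then have "AE \<omega> in P i. (\<Sum>n. ennreal (occ j n \<omega>)) \<noteq> \<infinity>"
    using assms by (intro nn_integral_PInf_AE) auto
  then show ?thesis
    by (simp add: less_top)
qed

text \<open>The occupation time of \<open>j\<close> increases with \<open>t\<close> and is
  sandwiched between its values at jump times, so countably many finite sums decide whether the
  killing comes before the lifetime. This also makes survival a measurable event.\<close>

lemma lifetime_le_killing_time_iff:
  assumes \<omega>: "\<omega> \<in> space (P i)" and c: "0 < w 0 + a"
  shows "lifetime X \<omega> \<le> killing_time j w X \<theta> a \<omega> \<longleftrightarrow>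
    (\<forall>n. ennreal (1 / (w 0 + a)) * ennreal (\<Sum>k<n. occ j k \<omega>) < ennreal (\<theta> \<omega>))"
proof -
  define L where "L t = (\<integral>\<^sup>+s. indicator {s. 0 \<le> s \<and> s \<le> t \<and> X s \<omega> = Some j} s \<partial>lborel)" for t :: real
  let ?I = "\<lambda>n. if Y n \<omega> = j then {arrival n \<omega>..<arrival (Suc n) \<omega>} else {}"
  have occ: "emeasure lborel (\<Union>k<n. ?I k) = ennreal (\<Sum>k<n. occ j k \<omega>)" for n
  proof -
    have "emeasure lborel (\<Union>k<n. ?I k) = (\<Sum>k<n. emeasure lborel (?I k))"
      using holding_intervals_disjoint[OF \<omega>, of j]
      by (intro sum_emeasure[symmetric]) (auto intro: disjoint_family_on_mono)
    then show ?thesis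
      by (simp add: emeasure_holding_interval[OF \<omega>] sum_ennreal occ_nonneg[OF \<omega>]
         )
  qed
  have L_le: "L t \<le> ennreal (\<Sum>k<n. occ j k \<omega>)" if "t < arrival n \<omega>" for t n
  proof -
    have "{s. 0 \<le> s \<and> s \<le> t \<and> X s \<omega> = Some j} \<subseteq> (\<Union>k<n. ?I k)"
    proof
      fix s assume s: "s \<in> {s. 0 \<le> s \<and> s \<le> t \<and> X s \<omega> = Some j}"
      then have "0 \<le> s" "s < arrival n \<omega>"
        using that by auto
      then obtain m where m: "m < n" "arrival m \<omega> \<le> s" "s < arrival (Suc m) \<omega>"
        by (rule chain_path_defined[OF \<omega>])
      then show "s \<in> (\<Union>k<n. ?I k)"
        using s chain_path_eq[OF \<omega> m(2,3)] by auto
    qed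
    then have "L t \<le> (\<integral>\<^sup>+s. indicator (\<Union>k<n. ?I k) s \<partial>lborel)"
      unfolding L_def by (intro nn_integral_mono indicator_leI) (rule subsetD)
    also have "\<dots> = emeasure lborel (\<Union>k<n. ?I k)"
      by (rule nn_integral_indicator) (auto intro!: sets.finite_UN)
    finally show ?thesis
      unfolding occ .
  qed
  have L_ge: "ennreal (\<Sum>k<n. occ j k \<omega>) \<le> L (arrival n \<omega>)" for n
  proof -
    have "(\<Union>k<n. ?I k) \<subseteq> {s. 0 \<le> s \<and> s \<le> arrival n \<omega> \<and> X s \<omega> = Some j}"
    proof
      fix s assume "s \<in> (\<Union>k<n. ?I k)"
      then obtain k where k: "k < n" "Y k \<omega> = j" "arrival k \<omega> \<le> s" "s < arrival (Suc k) \<omega>"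
        by (auto split: if_splits)
      then show "s \<in> {s. 0 \<le> s \<and> s \<le> arrival n \<omega> \<and> X s \<omega> = Some j}"
        using arrival_nonneg[OF \<omega>, of k] arrival_mono[OF \<omega>, of "Suc k" n]
          chain_path_eq[OF \<omega> k(3,4)] by auto
    qed
    then have "(\<integral>\<^sup>+s. indicator (\<Union>k<n. ?I k) s \<partial>lborel) \<le> L (arrival n \<omega>)"
      unfolding L_def by (intro nn_integral_mono indicator_leI) (rule subsetD)
    moreover have "(\<integral>\<^sup>+s. indicator (\<Union>k<n. ?I k) s \<partial>lborel) = emeasure lborel (\<Union>k<n. ?I k)"
      by (rule nn_integral_indicator) (auto intro!: sets.finite_UN)
    ultimately show ?thesis
      using occ by simp
  qed
  have "\<not> lifetime X \<omega> \<le> killing_time j w X \<theta> a \<omega> \<longleftrightarrow>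
      (\<exists>t\<ge>0. ennreal (\<theta> \<omega>) \<le> ennreal (1 / (w 0 + a)) * L t \<and> ennreal t < lifetime X \<omega>)"
    by (auto simp: not_le killing_time_def Inf_less_iff L_def)
  also have "\<dots> \<longleftrightarrow> (\<exists>n. ennreal (\<theta> \<omega>) \<le> ennreal (1 / (w 0 + a)) * ennreal (\<Sum>k<n. occ j k \<omega>))"
  proof (intro iffI; elim exE conjE)
    fix t assume t: "0 \<le> t" "ennreal (\<theta> \<omega>) \<le> ennreal (1 / (w 0 + a)) * L t" "ennreal t < lifetime X \<omega>"
    then obtain n where "t < arrival n \<omega>"
      using less_lifetime_iff[OF \<omega>] by blast
    then have "ennreal (1 / (w 0 + a)) * L t \<le> ennreal (1 / (w 0 + a)) * ennreal (\<Sum>k<n. occ j k \<omega>)"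
      by (intro mult_left_mono L_le) auto
    then show "\<exists>n. ennreal (\<theta> \<omega>) \<le> ennreal (1 / (w 0 + a)) * ennreal (\<Sum>k<n. occ j k \<omega>)"
      using t(2) order_trans by blast
  next
    fix n assume n: "ennreal (\<theta> \<omega>) \<le> ennreal (1 / (w 0 + a)) * ennreal (\<Sum>k<n. occ j k \<omega>)"
    have "ennreal (1 / (w 0 + a)) * ennreal (\<Sum>k<n. occ j k \<omega>)
        \<le> ennreal (1 / (w 0 + a)) * L (arrival n \<omega>)"
      by (intro mult_left_mono L_ge) auto
    then show "\<exists>t\<ge>0. ennreal (\<theta> \<omega>) \<le> ennreal (1 / (w 0 + a)) * L t \<and> ennreal t < lifetime X \<omega>"
      using n order_trans arrival_nonneg[OF \<omega>] arrival_less_lifetime[OF \<omega>] by blast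
  qed
  finally show ?thesis
    by (auto simp: not_less[symmetric])
qed

text \<open>A finite potential means that the total occupation time of \<open>j\<close> is almost
  surely finite, while the killing rate \<open>1 / (w 0 + a)\<close> tends to 0. For almost every
  path the clock is thus never reached once \<open>a\<close> is large.\<close>

lemma killed_event_tendsto:
  assumes A: "A \<in> sets (P i)"
    and \<theta> [measurable]: "\<theta> \<in> borel_measurable (P i)" and pos: "AE \<omega> in P i. 0 < \<theta> \<omega>"
    and fin: "potential P X i j < \<top>"
  shows "((\<lambda>a. measure (P i) {\<omega> \<in> space (P i).
      \<omega> \<in> A \<and> lifetime X \<omega> \<le> killing_time j w X \<theta> a \<omega>}) \<longlongrightarrow> measure (P i) A) at_top"
proof -
  interpret prob_space "P i" by (rule prob_space_P)
  let ?K = "\<lambda>a. {\<omega> \<in> space (P i). \<omega> \<in> A \<and>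
    (\<forall>n. ennreal (1 / (w 0 + a)) * ennreal (\<Sum>k<n. occ j k \<omega>) < ennreal (\<theta> \<omega>))}"
  note [measurable] = A
  have "((\<lambda>a. integral\<^sup>L (P i) (indicator (?K a) :: 'w \<Rightarrow> real)) \<longlongrightarrow> integral\<^sup>L (P i) (indicator A)) at_top"
  proof (rule integral_dominated_convergence_at_top[where w = "\<lambda>_. 1"])
    show "AE \<omega> in P i. ((\<lambda>a. indicator (?K a) \<omega> :: real) \<longlongrightarrow> indicator A \<omega>) at_top"
      using pos AE_occ_summable[OF fin] AE_space
    proof eventually_elim
      case (elim \<omega>)
      define L0 where "L0 = enn2real (\<Sum>n. ennreal (occ j n \<omega>))"
      have L0: "(\<Sum>n. ennreal (occ j n \<omega>)) = ennreal L0"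
        using elim by (simp add: L0_def less_top)
      have le: "ennreal (\<Sum>k<n. occ j k \<omega>) \<le> ennreal L0" for n
        unfolding L0[symmetric] using occ_nonneg[OF elim(3)]
        by (simp flip: sum_ennreal, intro sum_le_suminf) (auto intro: summableI)
      have "((\<lambda>a. 1 / (w 0 + a) * L0) \<longlongrightarrow> 0 * L0) at_top"
        by (intro tendsto_intros tendsto_divide_0[OF tendsto_const]
            filterlim_at_top_imp_at_infinity filterlim_tendsto_add_at_top[OF tendsto_const filterlim_ident])
      then have "\<forall>\<^sub>F a in at_top. 1 / (w 0 + a) * L0 < \<theta> \<omega>"
        using elim(1) by (intro order_tendstoD(2)[of _ 0]) auto
      moreover have "\<forall>\<^sub>F a in at_top. - w 0 < a"
        by (rule eventually_gt_at_top)
      ultimately have "\<forall>\<^sub>F a in at_top. indicator (?K a) \<omega> = (indicator A \<omega> :: real)"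
      proof eventually_elim
        case a: (elim a)
        have "ennreal (1 / (w 0 + a)) * ennreal (\<Sum>k<n. occ j k \<omega>) < ennreal (\<theta> \<omega>)" for n
        proof -
          have "ennreal (1 / (w 0 + a)) * ennreal (\<Sum>k<n. occ j k \<omega>)
              \<le> ennreal (1 / (w 0 + a)) * ennreal L0"
            by (intro mult_left_mono le) auto
          also have "\<dots> = ennreal (1 / (w 0 + a) * L0)"
            using a by (subst ennreal_mult) (auto simp: L0_def)
          also have "\<dots> < ennreal (\<theta> \<omega>)"
            using a elim(1) by (simp add: ennreal_lessI)
          finally show ?thesis .
        qed
        then show ?case
          using elim(3) by (auto simp: indicator_def)
      qed
      then show ?case
        by (rule tendsto_eventually)
    qed
  qed (auto intro!: always_eventually simp: indicator_def)
  \<comment> \<open>The rewriting of the survival event is available when \<open>w 0 + a\<close> is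
    positive, hence only eventually in \<open>a\<close>.\<close>
  moreover have "\<forall>\<^sub>F a in at_top. integral\<^sup>L (P i) (indicator (?K a) :: 'w \<Rightarrow> real) =
      measure (P i) {\<omega> \<in> space (P i). \<omega> \<in> A \<and> lifetime X \<omega> \<le> killing_time j w X \<theta> a \<omega>}"
    using eventually_gt_at_top[of "- w 0"]
  proof eventually_elim
    case (elim a)
    then have "?K a = {\<omega> \<in> space (P i). \<omega> \<in> A \<and> lifetime X \<omega> \<le> killing_time j w X \<theta> a \<omega>}"
      using lifetime_le_killing_time_iff[of _ i w a j \<theta>] by auto
    moreover have "?K a \<inter> space (P i) = ?K a"
      by auto
    then have "integral\<^sup>L (P i) (indicator (?K a) :: 'w \<Rightarrow> real) = measure (P i) (?K a)"
      by simp
    ultimately show ?case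
      by simp
  qed
  moreover have "integral\<^sup>L (P i) (indicator A :: 'w \<Rightarrow> real) = measure (P i) A"
    using sets.sets_into_space[OF A] by (simp add: Int_absorb2)
  ultimately show ?thesis
    using tendsto_cong by fastforce
qed

end

section \<open>The reflected chain on a tree\<close>

lemma Delta_pos: "strict_mono w \<Longrightarrow> 0 < w 0 \<Longrightarrow> 0 < Delta w n"
  by (cases n) (auto simp: Delta_def strict_mono_Suc_iff)

locale tree_chain = rooted_tree T r for T :: "('v :: countable \<times> 'v) set" and r +
  fixes w :: "nat \<Rightarrow> real" and P :: "'v \<Rightarrow> 'w measure" and Y :: "nat \<Rightarrow> 'w \<Rightarrow> 'v"
    and S :: "nat \<Rightarrow> 'w \<Rightarrow> real"
  assumes locally_finite: "locally_finite T"
    and root_succs: "succs T r r \<noteq> {}"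
    and w_mono: "strict_mono w" and w_pos: "0 < w 0"
    and reflected_chain: "minimal_chain (reflected_Q T r w) P Y S"
    and transient: "\<P>(\<omega> in P r. \<exists>\<xi>\<in>rays T r. exits_at T r (chain_path Y S) \<omega> \<xi>) = 1"
    and regular: "\<And>\<eta> i. \<eta> \<in> rays T r \<Longrightarrow>
      ((\<lambda>j. \<P>(\<omega> in P j. hitting_time (chain_path Y S) i \<omega> < \<top>)) \<longlongrightarrow> 0) (toward T r \<eta>)"
begin

section \<open>Conductances and reversibility\<close>

abbreviation Q :: "'v \<Rightarrow> 'v \<Rightarrow> real" where "Q \<equiv> reflected_Q T r w"

abbreviation nbrs :: "'v \<Rightarrow> 'v set" where "nbrs i \<equiv> {j. (i, j) \<in> T}"

lemma finite_nbrs: "finite (nbrs i)"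
  using locally_finite by (simp add: locally_finite_def)

lemma finite_succs: "finite (succs T r i)"
  by (rule finite_subset[OF _ finite_nbrs[of i]]) (auto intro: succs_adj)

lemmas Delta_w_pos = Delta_pos[OF w_mono w_pos]

text \<open>\<open>Delta w\<close> at the level of the child is the resistance of the edge, the same
  in both directions.\<close>

lemma Q_succs:
  assumes "j \<in> succs T r i"
  shows "Q i j = 1 / Delta w (lev j)" "Q j i = 1 / Delta w (lev j)"
proof -
  have "i \<noteq> j" "\<not> (i \<noteq> r \<and> j = parent T r i)"
    using lev_succs[OF assms] lev_succs[of i j] by (auto simp: succs_def)
  then show "Q i j = 1 / Delta w (lev j)" "Q j i = 1 / Delta w (lev j)"
    using assms lev_succs[OF assms] by (auto simp: reflected_Q_def Delta_def succs_def)
qed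

lemma Q_sym: "Q i j = Q j i"
proof (cases "(i, j) \<in> T")
  case True
  then show ?thesis
    using Q_succs by (auto simp: adj_iff)
next
  case False
  then show ?thesis
    by (auto simp: reflected_Q_def adj_iff succs_def)
qed

lemma Q_not_adj: "i \<noteq> j \<Longrightarrow> (i, j) \<notin> T \<Longrightarrow> Q i j = 0"
  by (auto simp: reflected_Q_def adj_iff succs_def)

lemma Q_adj_pos: "(i, j) \<in> T \<Longrightarrow> 0 < Q i j"
  using Q_succs Delta_w_pos by (auto simp: adj_iff)

lemma Q_diag_neg: "reflected_Q T r w i i < 0"
proof -
  have "0 < w (lev i + 1) - w (lev i)"
    using w_mono by (simp add: strict_mono_Suc_iff)
  \<comment> \<open>The root has no edge upwards, so its rate comes from its successors alone; at
    any other site the edge to the parent already gives a positive rate.\<close>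
  moreover have "0 < card (succs T r r)"
    using root_succs finite_succs by (simp add: card_gt_0_iff)
  moreover have "i \<noteq> r \<Longrightarrow> lev i \<noteq> 0"
    using geo_parent(1)[of i] length_geo[of i] length_geo[of "parent T r i"] by auto
  then have "i \<noteq> r \<Longrightarrow> 0 < w (lev i) - w (lev i - 1)"
    using Delta_w_pos[of "lev i"] by (simp add: Delta_def)
  moreover from calculation have
    "i \<noteq> r \<Longrightarrow> 0 < 1 / (w (lev i) - w (lev i - 1)) + card (succs T r i) / (w (lev i + 1) - w (lev i))"
    by (intro add_pos_nonneg) simp_all
  ultimately show ?thesis
    unfolding reflected_Q_def by (cases "i = r") (simp_all add: divide_pos_pos)
qed

sublocale hold_chain "reflected_Q T r w" P Y S
proof (rule hold_chain.intro[OF reflected_chain])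
  show "0 \<le> Q i j" if "i \<noteq> j" for i j
    using that Q_not_adj[of i j] Q_adj_pos[of i j] by (cases "(i, j) \<in> T") auto
qed (rule Q_diag_neg)

text \<open>Besides being the holding rate, this is the reversing measure of the jump chain.\<close>

definition rate :: "'v \<Rightarrow> real" where "rate i = - Q i i"

lemma rate_pos: "0 < rate i"
  using Q_diag_neg by (simp add: rate_def)

lemma rate_jump: "(i, j) \<in> T \<Longrightarrow> rate i * jump_prob Q i j = Q i j"
  using rate_pos[of i] irrefl_adj by (auto simp: jump_prob_def rate_def)

lemma jump_prob_adj: "jump_prob Q i j \<noteq> 0 \<longleftrightarrow> (i, j) \<in> T"
  using Q_not_adj[of i j] Q_adj_pos[of i j] Q_diag_neg[of i] irrefl_adj[of i]
  by (auto simp: jump_prob_def)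

lemma jump_prob_reversible: "rate i * jump_prob Q i j = rate j * jump_prob Q j i"
proof (cases "(i, j) \<in> T")
  case True
  then show ?thesis
    using rate_jump[OF True] rate_jump[OF sym_adj[OF True]] Q_sym by simp
next
  case False
  then show ?thesis
    using jump_prob_adj[of i j] jump_prob_adj[of j i] sym_adj[of j i] by auto
qed

text \<open>The first step of a path from \<open>i\<close> is the last step of the reversed path, so
  the induction expands one side backward and reads the other side forward.\<close>

lemma trans_prob_reversible: "rate i * trans_prob n i j = rate j * trans_prob n j i"
proof (induction n arbitrary: i)
  case 0
  then show ?case by (simp add: trans_prob_0)
next
  case (Suc n)
  have "rate i * trans_prob (Suc n) i j
      = (\<Sum>a\<in>nbrs i. (rate i * jump_prob Q i a) * trans_prob n a j)"
    by (subst trans_prob_backward[OF finite_nbrs[of i]])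
      (auto simp: jump_prob_adj sum_distrib_left mult.assoc)
  also have "\<dots> = (\<Sum>a\<in>nbrs i. jump_prob Q a i * (rate a * trans_prob n a j))"
    by (simp add: jump_prob_reversible[of i] mult_ac)
  also have "\<dots> = rate j * (\<Sum>a\<in>nbrs i. trans_prob n j a * jump_prob Q a i)"
    by (simp add: Suc.IH sum_distrib_left mult_ac)
  also have "(\<Sum>a\<in>nbrs i. trans_prob n j a * jump_prob Q a i) = trans_prob (Suc n) j i"
    by (rule trans_prob_forward[OF finite_nbrs, symmetric]) (auto simp: jump_prob_adj intro: sym_adj)
  finally show ?case .
qed

section \<open>Symmetry of potentials and separating sites\<close>

lemma potential_sum: "potential P X i j = (\<Sum>n. ennreal (trans_prob n i j / rate j))"
  by (simp only: potential_eq_sum nn_integral_occ rate_def)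

lemma potential_sym: "potential P X i j = potential P X j i"
proof -
  have "trans_prob n i j / rate j = trans_prob n j i / rate i" for n
    using trans_prob_reversible[of i n j] rate_pos[of i] rate_pos[of j] by (simp add: field_simps)
  then show ?thesis
    unfolding potential_sum by simp
qed

text \<open>\<open>A\<close> is a region that can be left only from \<open>a\<close>, so a path from
  inside to a target outside must visit \<open>a\<close> first.\<close>

lemma potential_hit:
  assumes A: "i \<in> A" "j \<notin> A \<or> j = a" "\<And>x y. \<lbrakk>x \<in> A; x \<noteq> a; (x, y) \<in> T\<rbrakk> \<Longrightarrow> y \<in> A"
  shows "potential P X i j = ennreal (hit_prob i a) * potential P X a j"
proof -
  have "green i j = ennreal (hit_prob i a) * green a j"
  proof (rule green_first_hit)
    fix \<omega> n assume step: "\<forall>n. jump_prob Q (Y n \<omega>) (Y (Suc n) \<omega>) \<noteq> 0"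
      and Y: "Y 0 \<omega> = i" "Y n \<omega> = j"
    show "\<exists>k\<le>n. Y k \<omega> = a"
    proof (rule ccontr)
      assume no: "\<not> (\<exists>k\<le>n. Y k \<omega> = a)"
      have "k \<le> n \<Longrightarrow> Y k \<omega> \<in> A" for k
      proof (induction k)
        case (Suc k)
        then show ?case
          using A(3)[of "Y k \<omega>" "Y (Suc k) \<omega>"] no step by (auto simp: jump_prob_adj)
      qed (use A(1) Y in simp)
      from this[of n] show False
        using A(2) Y no by auto
    qed
  qed
  then show ?thesis
    by (simp add: potential_green divide_ennreal_def mult.assoc)
qed

lemma below_closed: "x \<in> below a \<Longrightarrow> x \<noteq> a \<Longrightarrow> (x, y) \<in> T \<Longrightarrow> y \<in> below a"
  by (auto simp: adj_iff below_succs)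

lemma potential_below:
  assumes "i \<in> below a" "j \<notin> below a \<or> j = a"
  shows "potential P X i j = ennreal (hit_prob i a) * potential P X a j"
  using assms below_closed by (rule potential_hit)

text \<open>Here the separating site is the parent \<open>a\<close> of the branch at
  \<open>b\<close>, and the region is that branch together with \<open>a\<close>. Unlike
  \<open>potential_below\<close>, this allows targets in the other branches at
  \<open>a\<close>.\<close>

lemma potential_branch:
  assumes "b \<in> succs T r a" "i \<in> below b" "j \<notin> below b"
  shows "potential P X i j = ennreal (hit_prob i a) * potential P X a j"
proof (rule potential_hit)
  show "i \<in> insert a (below b)" "j \<notin> insert a (below b) \<or> j = a"
    using assms by auto
  fix x y assume x: "x \<in> insert a (below b)" "x \<noteq> a" "(x, y) \<in> T"
  show "y \<in> insert a (below b)"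
  proof (cases "x = b")
    case True
    then have "y = a \<or> y \<in> succs T r b"
      using x(3) assms(1) by (auto simp: adj_iff succs_def)
    then show ?thesis
      by (auto simp: below_succs)
  next
    case False
    then show ?thesis
      using x below_closed[of x b y] by auto
  qed
qed

section \<open>Transience and finiteness of potentials\<close>

lemma transient_AE: "AE \<omega> in P r. \<exists>\<xi>\<in>rays T r. exits_at T r X \<omega> \<xi>"
  by (rule prob_space.AE_prob_1[OF prob_space_P transient, THEN AE_mp]) (rule AE_I2, simp)

text \<open>A set that is not measurable has measure 0 by convention, so probability 1 forces
  measurability.\<close>

lemma exits_measurable: "{\<omega> \<in> space (P r). \<exists>\<xi>\<in>rays T r. exits_at T r X \<omega> \<xi>} \<in> sets (P r)"
  using transient by (rule contrapos_pp) (simp add: measure_notin_sets)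

text \<open>Convergence to a ray keeps the chain eventually in the branch of its first vertex after
  the root, so there is a last visit to the root.\<close>

lemma potential_root_finite: "potential P X r r < \<top>"
proof -
  have "AE \<omega> in P r. \<exists>n. Y n \<omega> = r \<and> (\<forall>l>n. Y l \<omega> \<noteq> r)"
    using transient_AE AE_start[of r] AE_space
  proof eventually_elim
    case (elim \<omega>)
    then obtain \<xi> where \<xi>: "\<xi> \<in> rays T r" "exits_at T r X \<omega> \<xi>"
      by auto
    have "\<forall>\<^sub>F n in sequentially. Y n \<omega> \<in> below (\<xi> 1)"
      using exits_at_limit[OF elim(3) \<xi>(2)] by (simp add: filterlim_toward[OF \<xi>(1)])
    then obtain N where N: "\<And>n. N \<le> n \<Longrightarrow> Y n \<omega> \<in> below (\<xi> 1)"
      by (auto simp: eventually_sequentially)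
    have "r \<notin> below (\<xi> 1)"
    proof
      assume "r \<in> below (\<xi> 1)"
      then have "lev (\<xi> 1) = lev r"
        unfolding root_below by (rule arg_cong)
      then show False
        using lev_rays[OF \<xi>(1), of 1] by simp
    qed
    then have "{n. Y n \<omega> = r} \<subseteq> {..<N}"
      using N not_le by blast
    then have fin: "finite {n. Y n \<omega> = r}"
      by (rule finite_subset) simp
    define m where "m = Max {n. Y n \<omega> = r}"
    have "m \<in> {n. Y n \<omega> = r}"
      unfolding m_def using fin elim(2) by (intro Max_in) auto
    moreover have "Y l \<omega> \<noteq> r" if "m < l" for l
      using Max_ge[OF fin, of l] that by (auto simp: m_def)
    ultimately show ?case
      by auto
  qed
  then have "green r r < \<top>"
    by (rule green_finite)
  then show ?thesis
    using rate_pos[of r] unfolding potential_green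
    by (simp add: ennreal_divide_eq_top_iff less_top[symmetric] rate_def)
qed

lemma green_step_le: "ennreal (jump_prob Q i a) * green a b \<le> green i b"
proof (cases "(i, a) \<in> T")
  case True
  have "green i b = (if i = b then 1 else 0) + (\<Sum>a\<in>nbrs i. ennreal (jump_prob Q i a) * green a b)"
    by (rule green_backward[OF finite_nbrs]) (simp add: jump_prob_adj)
  moreover have "ennreal (jump_prob Q i a) * green a b
      \<le> (\<Sum>a\<in>nbrs i. ennreal (jump_prob Q i a) * green a b)"
    using True by (intro member_le_sum[OF _ _ finite_nbrs]) auto
  ultimately show ?thesis
    by (simp add: add_increasing)
next
  case False
  then have "jump_prob Q i a = 0"
    using jump_prob_adj by blast
  then show ?thesis by simp
qed

text \<open>Finiteness passes from \<open>i\<close> to a successor \<open>j\<close>: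
  \<open>green j i\<close> is bounded by \<open>green i i\<close>, symmetry of potentials carries
  this to \<open>green i j\<close>, and a step from \<open>i\<close> to \<open>j\<close> of positive
  probability bounds \<open>green j j\<close>. Off the diagonal, the Green function is at most its
  value at the target.\<close>

lemma green_finite_all: "green i j < \<top>"
proof -
  have le: "green i j \<le> green j j" for i j
    using green_hit[of i j] mult_right_mono[of "ennreal (hit_prob i j)" 1 "green j j"] prob_le_1
    by (simp add: hit_prob_def)
  have fin: "potential P X i j < \<top> \<longleftrightarrow> green i j < \<top>" for i j
    using rate_pos[of j] unfolding potential_green
    by (simp add: ennreal_divide_eq_top_iff less_top[symmetric] rate_def)
  have "green j j < \<top>"
  proof (induction j rule: tree_induct)
    case root
    show ?case
      using potential_root_finite fin by simp
  next
    case (succ i j)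
    have "green j i < \<top>"
      using le[of j i] succ(2) by (rule le_less_trans)
    then have "green i j < \<top>"
      using fin potential_sym by metis
    moreover have "jump_prob Q i j > 0"
      using succs_adj[OF succ(1)] jump_prob_adj p_nonneg by (metis less_eq_real_def)
    ultimately show ?case
      using green_step_le[of i j j] by (auto simp: less_top[symmetric] ennreal_mult_eq_top_iff top_unique)
  qed
  with le[of i j] show ?thesis
    by (rule le_less_trans)
qed

section \<open>The potential kernel as a real function\<close>

definition v :: "'v \<Rightarrow> 'v \<Rightarrow> real" where "v i j = enn2real (potential P X i j)"

lemma potential_eq: "potential P X i j = ennreal (v i j)"
proof -
  have "potential P X i j < \<top>"
    using rate_pos[of j] green_finite_all[of i j] unfolding potential_green
    by (simp add: ennreal_divide_eq_top_iff less_top[symmetric] rate_def)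
  then show ?thesis
    by (simp add: v_def less_top)
qed

lemma v_nonneg [simp]: "0 \<le> v i j"
  by (simp add: v_def)

lemma v_sym: "v i j = v j i"
  by (simp add: v_def potential_sym[of i j])

lemma v_sums: "(\<lambda>n. trans_prob n i j / rate j) sums v i j"
proof -
  have "(\<Sum>n. ennreal (trans_prob n i j / rate j)) = ennreal (v i j)"
    using potential_eq potential_sum by simp
  moreover have nn: "0 \<le> trans_prob n i j / rate j" for n
    using rate_pos[of j] by simp
  ultimately have s: "summable (\<lambda>n. trans_prob n i j / rate j)"
    by (intro summable_suminf_not_top) auto
  then have "ennreal (\<Sum>n. trans_prob n i j / rate j) = ennreal (v i j)"
    using suminf_ennreal2[OF nn s] potential_eq[of i j] potential_sum[of i j] by simp
  then have "(\<Sum>n. trans_prob n i j / rate j) = v i j"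
    using suminf_nonneg[OF s nn] by (subst (asm) ennreal_inj) auto
  then show ?thesis
    using summable_sums[OF s] by simp
qed

lemma hit_prob_nonneg [simp]: "0 \<le> hit_prob i j"
  by (simp add: hit_prob_def)

lemma v_below:
  assumes "i \<in> below a" "j \<notin> below a \<or> j = a"
  shows "v i j = hit_prob i a * v a j"
  unfolding v_def using potential_below[OF assms] by (simp add: enn2real_mult)

lemma v_branch:
  assumes "b \<in> succs T r a" "i \<in> below b" "j \<notin> below b"
  shows "v i j = hit_prob i a * v a j"
  unfolding v_def using potential_branch[OF assms] by (simp add: enn2real_mult)

lemma green_eq: "green i j = ennreal (v i j * rate j)"
proof -
  have "green i j = potential P X i j * ennreal (rate j)"
    unfolding potential_green using rate_pos[of j]
    by (simp add: rate_def ennreal_divide_times ennreal_divide_self)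
  then show ?thesis
    using rate_pos[of j] by (simp add: potential_eq ennreal_mult)
qed

text \<open>The matrix identity \<open>- Q v = 1\<close>: multiplying the first-step equation of the
  jump chain by \<open>rate i\<close> replaces the jump probabilities by entries of
  \<open>Q\<close>.\<close>

lemma v_first_step:
  "rate i * v i b = (if i = b then 1 else 0) + (\<Sum>a\<in>nbrs i. Q i a * v a b)"
proof -
  have "green i b = (if i = b then 1 else 0) + (\<Sum>a\<in>nbrs i. ennreal (jump_prob Q i a) * green a b)"
    by (rule green_backward[OF finite_nbrs]) (simp add: jump_prob_adj)
  also have "\<dots> = ennreal (if i = b then 1 else 0) + (\<Sum>a\<in>nbrs i. ennreal (jump_prob Q i a * (v a b * rate b)))"
    using rate_pos[of b] p_nonneg by (simp add: green_eq ennreal_mult)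
  also have "\<dots> = ennreal ((if i = b then 1 else 0) + (\<Sum>a\<in>nbrs i. jump_prob Q i a * (v a b * rate b)))"
    using rate_pos[of b] p_nonneg by (simp add: sum_nonneg sum_ennreal)
  finally have "v i b * rate b = (if i = b then 1 else 0) + (\<Sum>a\<in>nbrs i. jump_prob Q i a * (v a b * rate b))"
    using rate_pos[of b] p_nonneg
    by (subst (asm) green_eq, subst (asm) ennreal_inj) (auto intro!: sum_nonneg add_nonneg_nonneg)
  then have "rate i * (v i b * rate b) = rate i * (if i = b then 1 else 0)
      + (\<Sum>a\<in>nbrs i. (rate i * jump_prob Q i a) * (v a b * rate b))"
    by (simp add: distrib_left sum_distrib_left mult.assoc)
  also have "(\<Sum>a\<in>nbrs i. (rate i * jump_prob Q i a) * (v a b * rate b)) = (\<Sum>a\<in>nbrs i. Q i a * v a b) * rate b"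
    by (simp add: sum_distrib_right mult.assoc rate_jump)
  finally have "(rate i * v i b) * rate b = ((if i = b then 1 else 0) + (\<Sum>a\<in>nbrs i. Q i a * v a b)) * rate b"
    by (auto simp: algebra_simps)
  then show ?thesis
    using rate_pos[of b] by (subst (asm) mult_right_cancel) auto
qed

lemma v_root_pos: "0 < v i r"
proof (induction i rule: tree_induct)
  case root
  have "1 \<le> green r r"
    by (subst green_backward[OF finite_nbrs]) (auto simp: jump_prob_adj)
  then show ?case
    using rate_pos[of r] v_nonneg[of r r] by (auto simp: green_eq less_eq_real_def)
next
  case (succ i j)
  have j: "(j, i) \<in> T"
    using succs_adj[OF succ(1)] by (rule sym_adj)
  have "0 < Q j i * v i r"
    using Q_adj_pos[OF j] succ(2) by simp
  also have "\<dots> \<le> (\<Sum>a\<in>nbrs j. Q j a * v a r)"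
    using j Q_adj_pos by (intro member_le_sum[OF _ _ finite_nbrs]) (auto intro!: mult_nonneg_nonneg simp: less_imp_le)
  also have "\<dots> \<le> rate j * v j r"
    by (simp add: v_first_step)
  finally show ?case
    using rate_pos[of j] by (simp add: zero_less_mult_iff)
qed

abbreviation g :: "'v \<Rightarrow> real" where "g i \<equiv> v i r"

text \<open>Both \<open>v i a\<close> and \<open>g i\<close> are the probability of hitting
  \<open>a\<close> from \<open>i\<close> times a value at \<open>a\<close>; the hitting probability
  is eliminated between them.\<close>

lemma v_below_root:
  assumes "i \<in> below a"
  shows "v i a * g a = g i * v a a"
  using v_below[OF assms, of a] v_below[OF assms, of r] root_below[of a] by auto

lemma nbrs_succ: "b \<in> succs T r a \<Longrightarrow> nbrs b = insert a (succs T r b)" "b \<in> succs T r a \<Longrightarrow> a \<notin> succs T r b"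
  using lev_succs[of b a] lev_succs[of a b] by (auto simp: adj_iff) (auto simp: succs_def)

text \<open>A discrete Wronskian on the edge. The first-step equations at \<open>b\<close> with
  targets \<open>b\<close> and \<open>r\<close> are cross-multiplied by \<open>g b\<close> and
  \<open>v b b\<close>; the sums over successors of \<open>b\<close> cancel by
  \<open>v_below_root\<close>, and \<open>v a b\<close> is expressed through \<open>v a a\<close> by
  symmetry.\<close>

lemma v_diag_succ:
  assumes b: "b \<in> succs T r a"
  shows "v b b / (g b)\<^sup>2 = v a a / (g a)\<^sup>2 + Delta w (lev b) / (g b * g a)"
proof -
  note nb = nbrs_succ[OF b]
  have br: "b \<noteq> r"
    using b by (simp add: succs_def)
  have 1: "rate b * v b b = 1 + (Q b a * v a b + (\<Sum>x\<in>succs T r b. Q b x * v x b))"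
    using v_first_step[of b b] nb finite_succs by simp
  have 2: "rate b * g b = Q b a * g a + (\<Sum>x\<in>succs T r b. Q b x * g x)"
    using v_first_step[of b r] nb finite_succs br by simp
  have "(\<Sum>x\<in>succs T r b. Q b x * v x b) * g b = (\<Sum>x\<in>succs T r b. Q b x * g x) * v b b"
    unfolding sum_distrib_right
    by (rule sum.cong) (simp_all add: mult.assoc v_below_root below_succs)
  then have "Q b a * g a * v b b = g b + Q b a * v a b * g b"
    using arg_cong[OF 1, of "\<lambda>x. x * g b"] arg_cong[OF 2, of "\<lambda>x. x * v b b"]
    by (simp add: algebra_simps)
  then have 3: "g a * v b b = Delta w (lev b) * g b + v a b * g b"
    using Q_succs(2)[OF b] Delta_w_pos[of "lev b"] by (simp add: field_simps)
  have "v b a * g a = g b * v a a"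
    using b by (intro v_below_root) (simp add: below_succs)
  then have 4: "v a b = g b * v a a / g a"
    using v_root_pos[of a] v_sym[of a b] by (simp add: field_simps)
  show ?thesis
    using 3 v_root_pos[of a] v_root_pos[of b] unfolding 4
    by (simp add: field_simps power2_eq_square)
qed

end

section \<open>The exit measure\<close>

context tree_chain
begin

section \<open>Exit events and the law of the exit point\<close>

definition exit_event :: "(nat \<Rightarrow> 'v) set \<Rightarrow> 'w set" where
  "exit_event A = {\<omega> \<in> space (P r). \<exists>\<xi>\<in>A. exits_at T r X \<omega> \<xi>}"

abbreviation \<mu> :: "(nat \<Rightarrow> 'v) measure" where "\<mu> \<equiv> exit_law T r (P r) X"

lemma exits_unique:
  assumes "\<omega> \<in> space (P i)" "\<xi> \<in> rays T r" "\<eta> \<in> rays T r" "exits_at T r X \<omega> \<xi>" "exits_at T r X \<omega> \<eta>"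
  shows "\<xi> = \<eta>"
  using limit_ray_unique[OF assms(2) exits_at_limit[OF assms(1,4)] assms(3) exits_at_limit[OF assms(1,5)]]
  by simp

lemma rays_through_subset: "rays_through T r i \<subseteq> rays T r"
  by (auto simp: rays_through_def)

lemma exit_event_disjoint:
  assumes "A \<subseteq> rays T r" "B \<subseteq> rays T r" "A \<inter> B = {}"
  shows "exit_event A \<inter> exit_event B = {}"
proof (rule equals0I)
  fix \<omega> assume "\<omega> \<in> exit_event A \<inter> exit_event B"
  then obtain \<xi> \<eta> where "\<omega> \<in> space (P r)" "\<xi> \<in> A" "\<eta> \<in> B"
    "exits_at T r X \<omega> \<xi>" "exits_at T r X \<omega> \<eta>"
    by (auto simp: exit_event_def)
  then show False
    using exits_unique[of \<omega> r \<xi> \<eta>] assms by blast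
qed

lemma exit_event_UN: "exit_event (\<Union>n\<in>I. A n) = (\<Union>n\<in>I. exit_event (A n))"
  unfolding exit_event_def by blast

lemma exit_event_Un: "exit_event (A \<union> B) = exit_event A \<union> exit_event B"
  unfolding exit_event_def by blast

text \<open>On convergent paths, the branch containing the limit is where the jump chain eventually
  stays. This event on the sites is visibly measurable.\<close>

lemma exit_event_through:
  "exit_event (rays_through T r i) =
    exit_event (rays T r) \<inter> {\<omega> \<in> space (P r). \<forall>\<^sub>F n in sequentially. Y n \<omega> \<in> below i}"
proof (intro set_eqI iffI)
  fix \<omega> assume "\<omega> \<in> exit_event (rays_through T r i)"
  then show "\<omega> \<in> exit_event (rays T r) \<inter> {\<omega> \<in> space (P r). \<forall>\<^sub>F n in sequentially. Y n \<omega> \<in> below i}"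
    using rays_through_subset[of i] exits_at_limit[of \<omega> r] limit_through(1)[of _ "\<lambda>n. Y n \<omega>" sequentially i]
    unfolding exit_event_def by auto
next
  fix \<omega> assume \<omega>: "\<omega> \<in> exit_event (rays T r) \<inter> {\<omega> \<in> space (P r). \<forall>\<^sub>F n in sequentially. Y n \<omega> \<in> below i}"
  then obtain \<xi> where \<xi>: "\<xi> \<in> rays T r" "exits_at T r X \<omega> \<xi>" "\<omega> \<in> space (P r)"
    by (auto simp: exit_event_def)
  have "\<xi> \<in> rays_through T r i"
  proof (rule ccontr)
    assume "\<xi> \<notin> rays_through T r i"
    then have "\<forall>\<^sub>F n in sequentially. Y n \<omega> \<notin> below i"
      by (rule limit_through(2)[OF \<xi>(1) exits_at_limit[OF \<xi>(3,2)]])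
    moreover have "\<forall>\<^sub>F n in sequentially. Y n \<omega> \<in> below i"
      using \<omega> by simp
    ultimately have "\<forall>\<^sub>F n in sequentially. False"
      by eventually_elim simp
    then show False
      by simp
  qed
  then show "\<omega> \<in> exit_event (rays_through T r i)"
    using \<xi> by (auto simp: exit_event_def)
qed

lemma exit_event_rays: "exit_event (rays T r) \<in> sets (P r)"
  using exits_measurable by (simp add: exit_event_def)

lemma sets_exit_law: "sets \<mu> = sigma_sets (rays T r) (range (rays_through T r))"
  unfolding exit_law_def using rays_through_subset by (intro sets_measure_of) auto

lemma space_exit_law [simp]: "space \<mu> = rays T r"
  unfolding exit_law_def using rays_through_subset by (intro space_measure_of) auto

lemma sets_exit_law_subset: "A \<in> sets \<mu> \<Longrightarrow> A \<subseteq> rays T r"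
  using sets.sets_into_space[of A \<mu>] by simp

lemma rays_through_sets [measurable]: "rays_through T r i \<in> sets \<mu>"
  by (auto simp: sets_exit_law)

text \<open>Exit events commute with countable unions and, because limits are unique, with
  complements in the boundary, so measurability passes from branches to the generated
  sigma-field.\<close>

lemma exit_event_sets: "A \<in> sets \<mu> \<Longrightarrow> exit_event A \<in> sets (P r)"
  unfolding sets_exit_law
proof (induction rule: sigma_sets.induct)
  case (Basic A)
  then obtain i where A: "A = rays_through T r i"
    by auto
  have "{\<omega> \<in> space (P r). \<forall>\<^sub>F n in sequentially. Y n \<omega> \<in> below i} \<in> sets (P r)"
    unfolding eventually_sequentially by measurable
  then show ?case
    unfolding A exit_event_through using exit_event_rays by auto
next
  case Empty
  then show ?case by (simp add: exit_event_def)
next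
  case (Compl A)
  have "A \<subseteq> rays T r"
    using Compl(1) sets_exit_law_subset by (simp add: sets_exit_law)
  then have "exit_event (rays T r - A) = exit_event (rays T r) - exit_event A"
    using exit_event_disjoint[of A "rays T r - A"] exit_event_Un[of A "rays T r - A"]
    by (auto simp: Un_absorb1)
  then show ?case
    using Compl(2) exit_event_rays by auto
next
  case (Union A)
  then show ?case
    by (simp add: exit_event_UN sets.countable_UN)
qed

text \<open>\<open>measure_of\<close> falls back to the null measure unless its set function is a
  measure, so countable additivity has to be checked; it holds as disjoint sets of rays have
  disjoint exit events.\<close>

lemma emeasure_exit_law:
  assumes "A \<in> sets \<mu>"
  shows "emeasure \<mu> A = emeasure (P r) (exit_event A)"
proof -
  have eq: "\<mu> = measure_of (rays T r) (range (rays_through T r)) (\<lambda>A. emeasure (P r) (exit_event A))"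
    by (simp add: exit_law_def exit_event_def)
  show ?thesis
  proof (rule emeasure_measure_of[OF eq _ _ _ assms])
    show "range (rays_through T r) \<subseteq> Pow (rays T r)"
      using rays_through_subset by auto
    show "positive (sets \<mu>) (\<lambda>A. emeasure (P r) (exit_event A))"
      by (simp add: positive_def exit_event_def)
    show "countably_additive (sets \<mu>) (\<lambda>A. emeasure (P r) (exit_event A))"
    proof (rule countably_additiveI)
      fix A :: "nat \<Rightarrow> (nat \<Rightarrow> 'v) set"
      assume A: "range A \<subseteq> sets \<mu>" "disjoint_family A"
      have "disjoint_family (\<lambda>n. exit_event (A n))"
        unfolding disjoint_family_on_def
      proof (intro ballI impI)
        fix m n :: nat assume "m \<noteq> n"
        then have "A m \<inter> A n = {}"
          using A(2) by (auto simp: disjoint_family_on_def)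
        moreover have "A m \<subseteq> rays T r" "A n \<subseteq> rays T r"
          using A(1) sets_exit_law_subset by auto
        ultimately show "exit_event (A m) \<inter> exit_event (A n) = {}"
          by (intro exit_event_disjoint)
      qed
      moreover have "range (\<lambda>n. exit_event (A n)) \<subseteq> sets (P r)"
        using A(1) exit_event_sets by auto
      ultimately show "(\<Sum>n. emeasure (P r) (exit_event (A n))) = emeasure (P r) (exit_event (\<Union>n. A n))"
        using suminf_emeasure[of "\<lambda>n. exit_event (A n)" "P r"] by (simp add: exit_event_UN)
    qed
  qed
qed

lemma prob_space_exit_law: "prob_space \<mu>"
proof
  have "emeasure \<mu> (rays T r) = emeasure (P r) (exit_event (rays T r))"
    using sets.top[of \<mu>] by (intro emeasure_exit_law) simp
  also have "\<dots> = 1"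
    using transient by (simp add: emeasure_P exit_event_def)
  finally show "emeasure \<mu> (space \<mu>) = 1"
    by simp
qed

lemma measure_exit_law: "A \<in> sets \<mu> \<Longrightarrow> measure \<mu> A = measure (P r) (exit_event A)"
  using emeasure_exit_law by (simp add: measure_def)

lemma measure_through_root [simp]: "measure \<mu> (rays_through T r r) = 1"
proof -
  have "rays_through T r r = space \<mu>"
    by (auto simp: rays_through_def rays_0)
  then show ?thesis
    using prob_space.prob_space[OF prob_space_exit_law] by simp
qed

section \<open>Flow through an edge and decay along rays\<close>

lemma occupation_tendsto_exit:
  "(\<lambda>n. measure (P r) {\<omega> \<in> space (P r). Y n \<omega> \<in> below i}) \<longlonglongrightarrow> measure \<mu> (rays_through T r i)"
proof -
  interpret prob_space "P r" by (rule prob_space_P)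
  let ?B = "\<lambda>n. {\<omega> \<in> space (P r). Y n \<omega> \<in> below i}" and ?E = "exit_event (rays_through T r i)"
  have E [measurable]: "?E \<in> sets (P r)"
    by (rule exit_event_sets) simp
  have "(\<lambda>n. integral\<^sup>L (P r) (indicator (?B n) :: 'w \<Rightarrow> real)) \<longlonglongrightarrow> integral\<^sup>L (P r) (indicator ?E)"
  proof (rule integral_dominated_convergence[where w = "\<lambda>_. 1"])
    show "AE \<omega> in P r. (\<lambda>n. indicator (?B n) \<omega> :: real) \<longlonglongrightarrow> indicator ?E \<omega>"
      using transient_AE AE_space
    proof eventually_elim
      case (elim \<omega>)
      then obtain \<xi> where \<xi>: "\<xi> \<in> rays T r" "exits_at T r X \<omega> \<xi>"
        by auto
      note lim = exits_at_limit[OF elim(2) \<xi>(2)]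
      \<comment> \<open>A convergent path is eventually inside or eventually outside the branch, so
        the indicators are eventually constant.\<close>
      have "\<forall>\<^sub>F n in sequentially. indicator (?B n) \<omega> = (indicator ?E \<omega> :: real)"
      proof (cases "\<xi> \<in> rays_through T r i")
        case True
        then have "\<omega> \<in> ?E"
          using \<xi> elim(2) by (auto simp: exit_event_def)
        then show ?thesis
          using limit_through(1)[OF \<xi>(1) lim True] elim(2) by (auto elim!: eventually_mono)
      next
        case False
        then have "\<omega> \<notin> ?E"
          using exits_unique[OF elim(2) \<xi>(1) _ \<xi>(2)] rays_through_subset[of i]
          by (auto simp: exit_event_def)
        then show ?thesis
          using limit_through(2)[OF \<xi>(1) lim False] by (auto elim!: eventually_mono)
      qed
      then show ?case
        by (rule tendsto_eventually)
    qed
  qed (auto simp: indicator_def)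
  moreover have "?B n \<inter> space (P r) = ?B n" "?E \<inter> space (P r) = ?E" for n
    by (auto simp: exit_event_def)
  ultimately show ?thesis
    by (simp add: measure_exit_law)
qed

text \<open>The edge from \<open>j\<close> to \<open>k\<close> is the only one between the branch at
  \<open>k\<close> and its complement.\<close>

lemma crossing:
  assumes k: "k \<in> succs T r j" and T: "(x, y) \<in> T"
  shows "x \<notin> below k \<and> y \<in> below k \<longleftrightarrow> x = j \<and> y = k"
    and "x \<in> below k \<and> y \<notin> below k \<longleftrightarrow> x = k \<and> y = j"
proof -
  have j: "j \<notin> below k"
    using nth_geo_above(1)[of j k] lev_succs[OF k] by auto
  have *: "b = k \<longleftrightarrow> a = j" if "b \<in> below k" "a \<notin> below k" "b \<in> succs T r a" for a b
    using that below_succs[OF that(3), of k] k by (auto simp: succs_def)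
  have up: "b \<in> below k" if "a \<in> below k" "b \<in> succs T r a" for a b
    using that by (simp add: below_succs)
  consider "y \<in> succs T r x" | "x \<in> succs T r y"
    using T by (auto simp: adj_iff)
  then show "x \<notin> below k \<and> y \<in> below k \<longleftrightarrow> x = j \<and> y = k"
    and "x \<in> below k \<and> y \<notin> below k \<longleftrightarrow> x = k \<and> y = j"
    using * up j below_self[of k] below_succs[of y x k] below_succs[of x y k] by metis+
qed

lemma edge_flow:
  assumes k: "k \<in> succs T r j"
  shows "g j - g k = Delta w (lev k) * measure \<mu> (rays_through T r k)"
proof -
  interpret prob_space "P r" by (rule prob_space_P)
  let ?b = "\<lambda>n. prob {\<omega> \<in> space (P r). Y n \<omega> \<in> below k}"
  let ?d = "\<lambda>n. trans_prob n r j * jump_prob Q j k - trans_prob n r k * jump_prob Q k j"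
  have step: "?b (Suc n) - ?b n = ?d n" for n
  proof -
    \<comment> \<open>The probability of being in the branch at both times occurs in
      \<open>?b (Suc n)\<close> and in \<open>?b n\<close> and cancels in the difference.\<close>
    let ?m = "prob {\<omega> \<in> space (P r). Y n \<omega> \<in> below k \<and> Y (Suc n) \<omega> \<in> below k}"
    have "?b (Suc n) = ?m + prob {\<omega> \<in> space (P r). Y n \<omega> \<notin> below k \<and> Y (Suc n) \<omega> \<in> below k}"
      by (subst finite_measure_Union[symmetric]) (auto intro!: arg_cong[where f = prob])
    also have "prob {\<omega> \<in> space (P r). Y n \<omega> \<notin> below k \<and> Y (Suc n) \<omega> \<in> below k}
        = prob {\<omega> \<in> space (P r). Y n \<omega> = j \<and> Y (Suc n) \<omega> = k}"
    proof (rule finite_measure_eq_AE)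
      show "AE \<omega> in P r. \<omega> \<in> {\<omega> \<in> space (P r). Y n \<omega> \<notin> below k \<and> Y (Suc n) \<omega> \<in> below k} \<longleftrightarrow>
          \<omega> \<in> {\<omega> \<in> space (P r). Y n \<omega> = j \<and> Y (Suc n) \<omega> = k}"
        using AE_step[of n r]
        by eventually_elim (simp add: jump_prob_adj crossing(1)[OF k])
    qed auto
    finally have 1: "?b (Suc n) = ?m + trans_prob n r j * jump_prob Q j k"
      by (simp add: trans_prob_step)
    have "?b n = ?m + prob {\<omega> \<in> space (P r). Y n \<omega> \<in> below k \<and> Y (Suc n) \<omega> \<notin> below k}"
      by (subst finite_measure_Union[symmetric]) (auto intro!: arg_cong[where f = prob])
    also have "prob {\<omega> \<in> space (P r). Y n \<omega> \<in> below k \<and> Y (Suc n) \<omega> \<notin> below k}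
        = prob {\<omega> \<in> space (P r). Y n \<omega> = k \<and> Y (Suc n) \<omega> = j}"
    proof (rule finite_measure_eq_AE)
      show "AE \<omega> in P r. \<omega> \<in> {\<omega> \<in> space (P r). Y n \<omega> \<in> below k \<and> Y (Suc n) \<omega> \<notin> below k} \<longleftrightarrow>
          \<omega> \<in> {\<omega> \<in> space (P r). Y n \<omega> = k \<and> Y (Suc n) \<omega> = j}"
        using AE_step[of n r]
        by eventually_elim (simp add: jump_prob_adj crossing(2)[OF k])
    qed auto
    finally have "?b n = ?m + trans_prob n r k * jump_prob Q k j"
      by (simp add: trans_prob_step)
    with 1 show ?thesis
      by simp
  qed
  have "k \<noteq> r"
    using k by (simp add: succs_def)
  have "AE \<omega> in P r. Y 0 \<omega> \<notin> below k"
    using AE_start[of r] by eventually_elim (use \<open>k \<noteq> r\<close> in \<open>simp add: root_below\<close>)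
  then have b0: "?b 0 = 0"
    by (subst prob_eq_0) auto
  have "?d sums (measure \<mu> (rays_through T r k) - ?b 0)"
    using telescope_sums[OF occupation_tendsto_exit[of k]] unfolding step .
  moreover have "?d sums (v r j * Q j k - v r k * Q j k)"
  proof -
    \<comment> \<open>By symmetry of \<open>Q\<close>, both crossing probabilities are the same
      conductance divided by the rate of the site that is left. Summed over time, they yield
      \<open>v r j\<close> and \<open>v r k\<close> with one common factor.\<close>
    have c: "Q j k / rate j = jump_prob Q j k" "Q j k / rate k = jump_prob Q k j"
      using rate_jump[OF succs_adj[OF k]] rate_jump[OF sym_adj[OF succs_adj[OF k]]]
        rate_pos[of j] rate_pos[of k] Q_sym[of j k]
      by (simp_all add: nonzero_divide_eq_eq mult.commute)
    have "(\<lambda>n. trans_prob n r j / rate j * Q j k - trans_prob n r k / rate k * Q j k)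
        sums (v r j * Q j k - v r k * Q j k)"
      by (intro sums_diff sums_mult2 v_sums)
    then show ?thesis
      by (simp add: c[symmetric])
  qed
  ultimately have "(v r j - v r k) * Q j k = measure \<mu> (rays_through T r k)"
    using b0 sums_unique2 by (fastforce simp: algebra_simps)
  then show ?thesis
    using Q_succs(1)[OF k] Delta_w_pos[of "lev k"] v_sym[of r] by (simp add: field_simps)
qed

text \<open>\<open>g (\<eta> n)\<close> is the probability of reaching the root from
  \<open>\<eta> n\<close>, times the constant \<open>g r\<close>; regularity sends that probability
  to 0.\<close>

lemma g_tendsto_0:
  assumes "\<eta> \<in> rays T r"
  shows "(\<lambda>n. g (\<eta> n)) \<longlonglongrightarrow> 0"
proof -
  have hp: "\<P>(\<omega> in P j. hitting_time X r \<omega> < \<top>) = hit_prob j r" for j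
    unfolding hit_prob_def by (rule arg_cong[where f = "measure (P j)"]) (simp add: hitting_time_finite cong: conj_cong)
  have "(\<lambda>n. hit_prob (\<eta> n) r * g r) \<longlonglongrightarrow> 0 * g r"
    using filterlim_compose[OF regular[OF assms, of r] ray_filterlim_toward[OF assms]]
    unfolding hp by (intro tendsto_intros)
  moreover have "g (\<eta> n) = hit_prob (\<eta> n) r * g r" for n
    by (rule v_below) auto
  ultimately show ?thesis
    by simp
qed

lemma ray_flow:
  "\<eta> \<in> rays T r \<Longrightarrow> g (\<eta> n) - g (\<eta> (Suc n)) = Delta w (Suc n) * measure \<mu> (cyl T r (Suc n) \<eta>)"
  using edge_flow[OF rays_Suc[of \<eta> n]] lev_rays[of \<eta> "Suc n"] by (simp add: cyl_def)

text \<open>The index shifts by one: the term at level \<open>Suc k\<close> belongs to the edge from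
  \<open>\<eta> k\<close> to \<open>\<eta> (Suc k)\<close>, so the telescoping tail starts with
  \<open>g (\<eta> k)\<close>.\<close>

lemma tail_sums:
  assumes "\<eta> \<in> rays T r"
  shows "(\<lambda>m. Delta w (m + Suc k) * measure \<mu> (cyl T r (m + Suc k) \<eta>)) sums g (\<eta> k)"
proof -
  have "(\<lambda>m. g (\<eta> (m + k)) - g (\<eta> (Suc m + k))) sums (g (\<eta> (0 + k)) - 0)"
    by (rule telescope_sums'[OF LIMSEQ_ignore_initial_segment[OF g_tendsto_0[OF assms]]])
  then show ?thesis
    using ray_flow[OF assms] by simp
qed

text \<open>If a cylinder were null, so would be all smaller ones along \<open>\<eta>\<close>, and
  the tail sum would make \<open>g (\<eta> n)\<close> vanish, against
  \<open>v_root_pos\<close>.\<close>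

lemma cyl_pos:
  assumes \<eta>: "\<eta> \<in> rays T r"
  shows "0 < measure \<mu> (cyl T r n \<eta>)"
proof (rule ccontr)
  assume "\<not> 0 < measure \<mu> (cyl T r n \<eta>)"
  then have 0: "measure \<mu> (cyl T r n \<eta>) = 0"
    using measure_nonneg[of \<mu> "cyl T r n \<eta>"] by linarith
  interpret prob_space \<mu> by (rule prob_space_exit_law)
  have "measure \<mu> (cyl T r (m + Suc n) \<eta>) = 0" for m
  proof -
    have "cyl T r (m + Suc n) \<eta> \<subseteq> cyl T r n \<eta>"
      using rays_agree_le[OF _ \<eta>, of _ "m + Suc n" n] by (auto simp: cyl_eq[OF \<eta>])
    then have "measure \<mu> (cyl T r (m + Suc n) \<eta>) \<le> measure \<mu> (cyl T r n \<eta>)"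
      by (intro finite_measure_mono) (auto simp: cyl_def)
    then show ?thesis
      using 0 by (simp add: measure_le_0_iff)
  qed
  then have "(\<lambda>_. 0) sums g (\<eta> n)"
    using tail_sums[OF \<eta>, of n] by simp
  then have "g (\<eta> n) = 0"
    using sums_unique2 sums_zero by blast
  then show False
    using v_root_pos[of "\<eta> n"] by simp
qed

end

section \<open>The processes \<open>G\<close> and the Martin kernel\<close>

lemma sum_Delta: "(\<Sum>n\<le>m. Delta w n) = w m"
  by (induction m) (auto simp: Delta_def)

context tree_chain
begin

text \<open>\<open>w\<close> at the meeting level is the sum of its increments over the levels that
  the two rays share. On the diagonal all levels are shared, and the series is the limit of
  \<open>w\<close>, finite or not.\<close>

lemma U_bdry_eq:
  assumes \<eta>: "\<eta> \<in> rays T r" and \<xi>: "\<xi> \<in> rays T r"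
  shows "U_bdry w \<eta> \<xi> = (\<Sum>n. ennreal (Delta w n) * indicator (cyl T r n \<eta>) \<xi>)"
proof (cases "\<eta> = \<xi>")
  case True
  have "(\<lambda>n. ennreal (w n)) \<longlonglongrightarrow> (\<Sum>n. ennreal (Delta w n))"
  proof -
    have "(\<lambda>N. \<Sum>n<Suc N. ennreal (Delta w n)) \<longlonglongrightarrow> (\<Sum>n. ennreal (Delta w n))"
      by (rule LIMSEQ_Suc[OF summable_LIMSEQ]) simp
    then show ?thesis
      using Delta_w_pos by (simp add: lessThan_Suc_atMost sum_ennreal less_imp_le sum_Delta)
  qed
  moreover have "indicator (cyl T r n \<eta>) \<xi> = (1 :: ennreal)" for n
    using True \<eta> by (simp add: cyl_eq)
  ultimately show ?thesis
    using True by (simp add: U_bdry_def limI)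
next
  case False
  then obtain m where m: "\<eta> m \<noteq> \<xi> m"
    by auto
  define M where "M = Max {n. \<eta> n = \<xi> n}"
  have sub: "{n. \<eta> n = \<xi> n} \<subseteq> {..<m}"
    using rays_agree_le[OF \<eta> \<xi>] m by (auto simp: not_le[symmetric])
  then have fin: "finite {n. \<eta> n = \<xi> n}"
    by (rule finite_subset) simp
  have "0 \<in> {n. \<eta> n = \<xi> n}"
    using rays_0[OF \<eta>] rays_0[OF \<xi>] by simp
  then have "M \<in> {n. \<eta> n = \<xi> n}"
    unfolding M_def using fin by (intro Max_in) auto
  then have iff: "\<xi> n = \<eta> n \<longleftrightarrow> n \<le> M" for n
    using rays_agree_le[OF \<eta> \<xi>, of M n] Max_ge[OF fin, of n] by (auto simp: M_def)
  have "(\<Sum>n. ennreal (Delta w n) * indicator (cyl T r n \<eta>) \<xi>)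
      = (\<Sum>n\<le>M. ennreal (Delta w n) * indicator (cyl T r n \<eta>) \<xi>)"
    using \<xi> by (intro suminf_finite) (auto simp: cyl_eq[OF \<eta>] iff)
  also have "\<dots> = (\<Sum>n\<le>M. ennreal (Delta w n))"
    using \<xi> by (intro sum.cong) (auto simp: cyl_eq[OF \<eta>] iff)
  also have "\<dots> = ennreal (w M)"
    using Delta_w_pos by (simp add: sum_ennreal less_imp_le sum_Delta)
  finally show ?thesis
    using False by (simp add: U_bdry_def M_def)
qed

lemma cyl_sets [measurable]: "cyl T r n \<eta> \<in> sets \<mu>"
  by (simp add: cyl_def)

lemma emeasure_\<mu>: "emeasure \<mu> A = ennreal (measure \<mu> A)"
proof -
  interpret prob_space \<mu> by (rule prob_space_exit_law)
  show ?thesis by (rule emeasure_eq_measure)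
qed

lemma total_sums:
  assumes "\<eta> \<in> rays T r"
  shows "(\<lambda>n. Delta w n * measure \<mu> (cyl T r n \<eta>)) sums (w 0 + g r)"
proof -
  have "(\<lambda>n. Delta w (Suc n) * measure \<mu> (cyl T r (Suc n) \<eta>)) sums g (\<eta> 0)"
    using tail_sums[OF assms, of 0] by simp
  then show ?thesis
    using rays_0[OF assms] by (subst (asm) sums_Suc_iff) (simp add: Delta_def cyl_def add.commute)
qed

text \<open>The series for \<open>U_bdry\<close> is integrated term by term. The value is constant
  because telescoping leaves \<open>g\<close> only at the starting vertex, which is the root for
  every ray.\<close>

lemma G_zero_eq:
  assumes \<eta>: "\<eta> \<in> rays T r"
  shows "G_zero T r w P X \<eta> = ennreal (g r + w 0)"
proof -
  have "G_zero T r w P X \<eta> = (\<integral>\<^sup>+\<xi>. (\<Sum>n. ennreal (Delta w n) * indicator (cyl T r n \<eta>) \<xi>) \<partial>\<mu>)"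
    unfolding G_zero_def by (rule nn_integral_cong) (simp add: U_bdry_eq[OF \<eta>])
  also have "\<dots> = (\<Sum>n. ennreal (Delta w n * measure \<mu> (cyl T r n \<eta>)))"
    using Delta_w_pos
    by (subst nn_integral_suminf) (auto simp: nn_integral_cmult emeasure_\<mu> ennreal_mult less_imp_le)
  also have "\<dots> = ennreal (w 0 + g r)"
    using total_sums[OF \<eta>] Delta_w_pos
    by (intro suminf_ennreal_eq) (auto intro!: mult_nonneg_nonneg simp: less_imp_le)
  finally show ?thesis
    by (simp add: add.commute)
qed

lemma partial_sum:
  assumes \<eta>: "\<eta> \<in> rays T r"
  shows "(\<Sum>n<Suc k. Delta w n * measure \<mu> (cyl T r n \<eta>)) = w 0 + g r - g (\<eta> k)"
proof (induction k)
  case 0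
  then show ?case
    using rays_0[OF \<eta>] by (simp add: Delta_def cyl_def)
next
  case (Suc k)
  then show ?case
    using ray_flow[OF \<eta>, of k] by simp
qed

lemma G_killed_tendsto:
  assumes \<eta>: "\<eta> \<in> rays T r" and clock: "exp_clock P Y S \<theta>"
  shows "((\<lambda>a. G_killed T r w P X \<theta> a (Suc k) \<eta>) \<longlongrightarrow> ennreal (g (\<eta> k))) at_top"
proof -
  have D: "distributed (P r) lborel \<theta> (exponential_density 1)"
    using clock by (simp add: exp_clock_def)
  have \<theta>: "\<theta> \<in> borel_measurable (P r)"
    using distributed_measurable[OF D] by simp
  interpret prob_space "P r" by (rule prob_space_P)
  have "prob {\<omega> \<in> space (P r). \<theta> \<omega> \<le> 0} = 0"
    using exponential_distributedD_le[OF D, of 0] by simp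
  then have pos: "AE \<omega> in P r. 0 < \<theta> \<omega>"
    using \<theta> by (subst (asm) prob_eq_0) (auto elim!: eventually_mono)
  define K where "K a = measure (P r) {\<omega> \<in> space (P r). lifetime X \<omega> \<le> killing_time r w X \<theta> a \<omega>}" for a
  define N where "N A a = measure (P r) {\<omega> \<in> space (P r). \<omega> \<in> exit_event A \<and> lifetime X \<omega> \<le> killing_time r w X \<theta> a \<omega>}" for A a
  have mu_killed: "mu_killed T r w P X \<theta> a A = N A a / K a" for a A
    unfolding mu_killed_def cond_prob_def N_def K_def
    by (intro arg_cong2[where f = "(/)"] arg_cong[where f = "measure (P r)"]) (auto simp: exit_event_def)
  have K: "(K \<longlongrightarrow> 1) at_top"
    using killed_event_tendsto[OF sets.top \<theta> pos potential_root_finite, of w]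
    unfolding K_def by (simp add: prob_space cong: conj_cong)
  have N: "(N A \<longlongrightarrow> measure \<mu> A) at_top" if "A \<in> sets \<mu>" for A
    using killed_event_tendsto[OF exit_event_sets[OF that] \<theta> pos potential_root_finite, of w] that
    unfolding N_def measure_exit_law[OF that] by simp
  have N_le: "N A a \<le> measure \<mu> A" if "A \<in> sets \<mu>" for A a
    unfolding measure_exit_law[OF that] N_def
    using exit_event_sets[OF that] by (intro finite_measure_mono) auto
  let ?f = "\<lambda>m a. Delta w (m + Suc k) * mu_killed T r w P X \<theta> a (cyl T r (m + Suc k) \<eta>)"
  let ?b = "\<lambda>m. Delta w (m + Suc k) * measure \<mu> (cyl T r (m + Suc k) \<eta>)"
  have b: "?b sums g (\<eta> k)"
    by (rule tail_sums[OF \<eta>])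
  have f_nonneg: "0 \<le> ?f m a" for m a
    using Delta_w_pos by (auto intro!: mult_nonneg_nonneg simp: mu_killed N_def K_def less_imp_le)
  \<comment> \<open>The factor 2 arises because conditioning on an event of probability above 1/2 at
    most doubles a probability.\<close>
  have bound: "\<forall>\<^sub>F a in at_top. \<forall>m. norm (?f m a) \<le> 2 * ?b m"
  proof -
    have "\<forall>\<^sub>F a in at_top. 1 / 2 < K a"
      using K by (rule order_tendstoD) simp
    then show ?thesis
    proof (eventually_elim, intro allI)
      case (elim a)
      fix m
      have "N (cyl T r (m + Suc k) \<eta>) a / K a \<le> measure \<mu> (cyl T r (m + Suc k) \<eta>) / (1 / 2)"
        using elim by (intro frac_le N_le) auto
      then have "?f m a \<le> Delta w (m + Suc k) * (2 * measure \<mu> (cyl T r (m + Suc k) \<eta>))"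
        unfolding mu_killed using Delta_w_pos by (intro mult_left_mono) (auto simp: less_imp_le)
      then show "norm (?f m a) \<le> 2 * ?b m"
        using f_nonneg[of m a] by simp
    qed
  qed
  have lim: "(?f m \<longlongrightarrow> ?b m) at_top" for m
    unfolding mu_killed using tendsto_divide[OF N K] by (intro tendsto_intros) auto
  \<comment> \<open>The bound holds for all \<open>m\<close> at once, so on the side of
    \<open>m\<close> the product filter needs no restriction.\<close>
  have bound': "\<forall>\<^sub>F (m, a) in at_top \<times>\<^sub>F at_top. norm (?f m a) \<le> 2 * ?b m"
    unfolding eventually_prod_filter using bound
    by (intro exI[of _ "\<lambda>_. True"] exI[of _ "\<lambda>a. \<forall>m. norm (?f m a) \<le> 2 * ?b m"]) auto
  have "summable (\<lambda>m. 2 * ?b m)"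
    using b by (intro summable_mult) (simp add: sums_iff)
  note tannery = tannerys_theorem[of ?f ?b at_top "\<lambda>m. 2 * ?b m", OF lim bound' this trivial_limit_at_top_linorder]
  have "\<forall>\<^sub>F a in at_top. ennreal (\<Sum>m. ?f m a) = G_killed T r w P X \<theta> a (Suc k) \<eta>"
    using conjunct1[OF tannery]
  proof eventually_elim
    case (elim a)
    then have "summable (\<lambda>m. ?f m a)"
      by (rule summable_norm_cancel)
    then have "(\<Sum>m. ennreal (?f m a)) = ennreal (\<Sum>m. ?f m a)"
      using f_nonneg by (intro suminf_ennreal2) auto
    \<comment> \<open>All levels here are at least 1, where the shift by \<open>a\<close> cancels in
      the increments.\<close>
    then show ?case
      by (simp add: G_killed_def Delta_def)
  qed
  moreover have "((\<lambda>a. ennreal (\<Sum>m. ?f m a)) \<longlongrightarrow> ennreal (g (\<eta> k))) at_top"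
    using tannery b by (intro tendsto_ennrealI) (simp add: sums_iff)
  ultimately show ?thesis
    by (rule Lim_transform_eventually[rotated])
qed

lemma G_lim_eq:
  "\<eta> \<in> rays T r \<Longrightarrow> exp_clock P Y S \<theta> \<Longrightarrow> G_lim T r w P X \<theta> (Suc k) \<eta> = g (\<eta> k)"
  unfolding G_lim_def by (subst tendsto_Lim[OF _ G_killed_tendsto]) auto

lemma boundary_field_space: "space (boundary_field T r k) = rays T r"
  unfolding boundary_field_def using rays_through_subset by (intro space_measure_of) auto

text \<open>\<open>G\<close> at time \<open>Suc k\<close> is \<open>g\<close> of the vertex at level
  \<open>k\<close>, so predictability reduces to measurability of one coordinate. The preimage of a
  site under it is a cylinder, or empty if the site has another level.\<close>

lemma boundary_field_measurable:
  "(\<lambda>\<eta>. f (\<eta> k)) \<in> borel_measurable (boundary_field T r k)" for f :: "'v \<Rightarrow> real"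
proof -
  have sub: "{rays_through T r i | i. lev i = k} \<subseteq> Pow (rays T r)"
    using rays_through_subset by auto
  have "(\<lambda>\<eta>. \<eta> k) \<in> boundary_field T r k \<rightarrow>\<^sub>M count_space UNIV"
  proof (subst measurable_count_space_eq2_countable, intro conjI ballI)
    fix i
    have "(\<lambda>\<eta>. \<eta> k) -` {i} \<inter> rays T r = (if lev i = k then rays_through T r i else {})"
      using lev_rays by (auto simp: rays_through_def)
    then show "(\<lambda>\<eta>. \<eta> k) -` {i} \<inter> space (boundary_field T r k) \<in> sets (boundary_field T r k)"
      unfolding boundary_field_space unfolding boundary_field_def sets_measure_of[OF sub]
      by (auto intro: sigma_sets.Empty)
  qed auto
  then show ?thesis
    by (rule measurable_compose) simp
qed

section \<open>Conditional means of the tree matrix\<close>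

lemma U_site_eq:
  assumes "\<xi> \<in> rays T r"
  shows "U_site T r w i \<xi> = (\<Sum>l\<le>lev i. Delta w l * indicator (rays_through T r (geo i ! l)) \<xi>)"
proof -
  let ?m = "meet_level T r i \<xi>"
  have iff: "\<xi> \<in> rays_through T r (geo i ! l) \<longleftrightarrow> l \<le> ?m" if "l \<le> lev i" for l
  proof -
    have "\<xi> \<in> rays_through T r (geo i ! l) \<longleftrightarrow> \<xi> l = geo i ! l"
      using assms by (simp add: rays_through_def lev_nth_geo[OF that])
    also have "\<dots> \<longleftrightarrow> i \<in> below (\<xi> l)"
      using nth_geo_above(2)[of i "\<xi> l"] below_nth_geo[OF that] lev_rays[OF assms, of l] by metis
    finally show ?thesis
      unfolding le_meet_level[OF assms] .
  qed
  have "U_site T r w i \<xi> = (\<Sum>l\<le>?m. Delta w l)"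
    by (simp add: U_site_def sum_Delta)
  also have "\<dots> = (\<Sum>l\<le>lev i. Delta w l * indicator (rays_through T r (geo i ! l)) \<xi>)"
    using meet_level_le[OF assms, of i] iff
    by (intro sum.mono_neutral_cong_left) auto
  finally show ?thesis .
qed

lemma nth_geo_succs:
  assumes "l < lev i"
  shows "geo i ! Suc l \<in> succs T r (geo i ! l)"
  unfolding succs_iff using assms nth_geo[of l i] nth_geo[of "Suc l" i] length_geo[of i]
  by (simp add: take_Suc_conv_app_nth)

lemma geodesic_flow:
  assumes "k \<le> m" "m \<le> lev i"
  shows "(\<Sum>l\<in>{k<..m}. Delta w l * measure \<mu> (rays_through T r (geo i ! l))) = g (geo i ! k) - g (geo i ! m)"
  using assms
proof (induction m rule: dec_induct)
  case (step m)
  have "{k<..Suc m} = insert (Suc m) {k<..m}"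
    using step by auto
  then show ?case
    using step edge_flow[OF nth_geo_succs[of m i]] lev_nth_geo[of "Suc m" i] by simp
qed simp

text \<open>\<open>U_site\<close> is layered along the geodesic to \<open>i\<close>. All rays of the
  cylinder share its vertices up to level \<open>k\<close>, which contributes \<open>w k\<close>;
  the rays through a deeper vertex all lie in the cylinder, and these contributions telescope by
  \<open>geodesic_flow\<close>.\<close>

lemma cond_mean_above:
  assumes \<eta>: "\<eta> \<in> rays T r" and k: "k \<le> meet_level T r i \<eta>"
  shows "cond_mean T r \<mu> (U_site T r w i) k \<eta> = w k + (g (\<eta> k) - g i) / measure \<mu> (cyl T r k \<eta>)"
proof -
  interpret prob_space \<mu> by (rule prob_space_exit_law)
  let ?C = "cyl T r k \<eta>"
  have i: "i \<in> below (\<eta> k)"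
    using k by (simp add: le_meet_level[OF \<eta>])
  then have k': "k \<le> lev i" "geo i ! k = \<eta> k"
    using nth_geo_above[OF i] lev_rays[OF \<eta>] by auto
  \<comment> \<open>The cylinder is that of a vertex on the geodesic to \<open>i\<close>, hence
    comparable with every other vertex on it: one of the two sets contains the other.\<close>
  have inter: "rays_through T r (geo i ! l) \<inter> ?C = (if l \<le> k then ?C else rays_through T r (geo i ! l))"
    if l: "l \<le> lev i" for l
  proof -
    have "?C \<subseteq> rays_through T r (geo i ! l)" if "l \<le> k"
    proof
      fix \<xi> assume "\<xi> \<in> ?C"
      then have \<xi>: "\<xi> \<in> rays T r" "\<xi> k = geo i ! k"
        by (auto simp: cyl_eq[OF \<eta>] k')
      have "\<xi> k \<in> below (geo i ! l)"
        unfolding \<xi> using below_above_cases[OF below_nth_geo[OF l] below_nth_geo[OF k'(1)]] that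
        by (simp add: lev_nth_geo l k'(1))
      then show "\<xi> \<in> rays_through T r (geo i ! l)"
        using rays_below_iff[OF \<xi>(1), of "geo i ! l" k] lev_nth_geo[OF l] that by simp
    qed
    moreover have "rays_through T r (geo i ! l) \<subseteq> ?C" if "\<not> l \<le> k"
    proof
      fix \<xi> assume *: "\<xi> \<in> rays_through T r (geo i ! l)"
      then have \<xi>: "\<xi> \<in> rays T r" "\<xi> l = geo i ! l"
        by (auto simp: rays_through_def lev_nth_geo[OF l])
      have "\<xi> l \<in> below (\<eta> k)"
        unfolding \<xi> k'(2)[symmetric]
        using below_above_cases[OF below_nth_geo[OF k'(1)] below_nth_geo[OF l]] that
        by (simp add: lev_nth_geo l k'(1))
      then have "\<xi> \<in> rays_through T r (\<eta> k)"
        using rays_below_iff[OF \<xi>(1), of "\<eta> k" l] lev_rays[OF \<eta>] that by simp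
      then show "\<xi> \<in> ?C"
        by (simp add: cyl_def)
    qed
    ultimately show ?thesis
      by auto
  qed
  have "(LINT \<xi>:?C|\<mu>. U_site T r w i \<xi>)
      = (LINT \<xi>|\<mu>. (\<Sum>l\<le>lev i. Delta w l * indicator (rays_through T r (geo i ! l) \<inter> ?C) \<xi>))"
    unfolding set_lebesgue_integral_def
  proof (rule Bochner_Integration.integral_cong[OF refl])
    fix \<xi> assume "\<xi> \<in> space \<mu>"
    then show "indicator ?C \<xi> *\<^sub>R U_site T r w i \<xi>
        = (\<Sum>l\<le>lev i. Delta w l * indicator (rays_through T r (geo i ! l) \<inter> ?C) \<xi>)"
      by (cases "\<xi> \<in> ?C") (simp_all add: U_site_eq indicator_def)
  qed
  also have "\<dots> = (\<Sum>l\<le>lev i. Delta w l * measure \<mu> (rays_through T r (geo i ! l) \<inter> ?C))"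
    by (subst Bochner_Integration.integral_sum)
      (auto intro!: integrable_mult_right integrable_real_indicator sum.cong
        simp: emeasure_\<mu> less_top[symmetric] dest: subsetD[OF rays_through_subset] intro!: arg_cong[where f = "measure \<mu>"])
  also have "\<dots> = (\<Sum>l\<le>k. Delta w l * measure \<mu> ?C)
      + (\<Sum>l\<in>{k<..lev i}. Delta w l * measure \<mu> (rays_through T r (geo i ! l)))"
  proof -
    have split: "{..lev i} = {..k} \<union> {k<..lev i}"
      using k' by auto
    show ?thesis
      unfolding split using k'
      by (subst sum.union_disjoint) (auto simp: inter intro!: arg_cong2[where f = "(+)"] sum.cong)
  qed
  also have "\<dots> = w k * measure \<mu> ?C + (g (\<eta> k) - g i)"
    using geodesic_flow[OF k'(1) order_refl] nth_geo_above(2)[of i i]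
    by (simp add: sum_distrib_right[symmetric] sum_Delta k')
  finally show ?thesis
    using cyl_pos[OF \<eta>, of k] by (simp add: cond_mean_def field_simps)
qed

text \<open>Past the separation, all rays of the cylinder leave the geodesic to \<open>i\<close> at
  the same vertex, so the function being averaged is constant.\<close>

lemma cond_mean_beyond:
  fixes i :: 'v
  assumes \<eta>: "\<eta> \<in> rays T r"
  defines "m \<equiv> meet_level T r i \<eta>"
  shows "cond_mean T r \<mu> (U_site T r w i) (Suc m) \<eta> = w m"
proof -
  interpret prob_space \<mu> by (rule prob_space_exit_law)
  have "meet_level T r i \<xi> = m" if "\<xi> \<in> cyl T r (Suc m) \<eta>" for \<xi>
  proof -
    have \<xi>: "\<xi> \<in> rays T r" "\<xi> (Suc m) = \<eta> (Suc m)" "\<xi> m = \<eta> m"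
      using that rays_agree_le[OF _ \<eta>, of \<xi> "Suc m" m] by (auto simp: cyl_eq[OF \<eta>])
    have "m \<le> meet_level T r i \<xi>" "\<not> Suc m \<le> meet_level T r i \<xi>"
      unfolding le_meet_level[OF \<xi>(1)] \<xi> le_meet_level[OF \<eta>, symmetric] by (auto simp: m_def)
    then show ?thesis
      by simp
  qed
  then have "(LINT \<xi>:cyl T r (Suc m) \<eta>|\<mu>. U_site T r w i \<xi>)
      = (LINT \<xi>|\<mu>. w m * indicator (cyl T r (Suc m) \<eta>) \<xi>)"
    unfolding set_lebesgue_integral_def
    by (intro Bochner_Integration.integral_cong) (auto simp: U_site_def indicator_def)
  also have "\<dots> = w m * measure \<mu> (cyl T r (Suc m) \<eta>)"
    by (simp add: Int_absorb2[OF sets.sets_into_space[OF cyl_sets, simplified]])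
  finally show ?thesis
    using cyl_pos[OF \<eta>, of "Suc m"] by (simp add: cond_mean_def)
qed

text \<open>The second summand on the right is cancelled by the last term of the full sum, the one for
  \<open>k = |i \<and> \<eta>| + 1\<close>.\<close>

lemma martin_sum_above:
  assumes \<eta>: "\<eta> \<in> rays T r" and "s \<le> meet_level T r i \<eta>"
  shows "1 + (\<Sum>k=1..s. 1 / g (\<eta> (k - 1)) *
      (cond_mean T r \<mu> (U_site T r w i) k \<eta> - cond_mean T r \<mu> (U_site T r w i) (k - 1) \<eta>))
    = g i * (v (\<eta> s) (\<eta> s) / (g (\<eta> s))\<^sup>2) + (1 - g i / g (\<eta> s)) / measure \<mu> (cyl T r s \<eta>)"
  using assms(2)
proof (induction s)
  case 0
  have "cyl T r 0 \<eta> = rays_through T r r"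
    using rays_0[OF \<eta>] by (simp add: cyl_def)
  then show ?case
    using rays_0[OF \<eta>] v_root_pos[of r] by (simp add: power2_eq_square field_simps)
next
  case (Suc s)
  let ?M = "measure \<mu> (cyl T r s \<eta>)" and ?N = "measure \<mu> (cyl T r (Suc s) \<eta>)"
  let ?x = "g (\<eta> s)" and ?y = "g (\<eta> (Suc s))" and ?D = "Delta w (Suc s)"
  have pos: "0 < ?M" "0 < ?N" "0 < ?x" "0 < ?y"
    using cyl_pos[OF \<eta>] v_root_pos by auto
  have D: "?D * ?N = ?x - ?y"
    using ray_flow[OF \<eta>, of s] by simp
  have K: "v (\<eta> (Suc s)) (\<eta> (Suc s)) / ?y\<^sup>2 = v (\<eta> s) (\<eta> s) / ?x\<^sup>2 + ?D / (?y * ?x)"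
    using v_diag_succ[OF rays_Suc[OF \<eta>, of s]] lev_rays[OF \<eta>, of "Suc s"] by simp
  have "cond_mean T r \<mu> (U_site T r w i) (Suc s) \<eta> - cond_mean T r \<mu> (U_site T r w i) s \<eta>
      = ?D + (?y - g i) / ?N - (?x - g i) / ?M"
    using cond_mean_above[OF \<eta>, of "Suc s" i] cond_mean_above[OF \<eta>, of s i] Suc.prems
    by (simp add: Delta_def)
  also have "\<dots> = (?x - g i) * (1 / ?N - 1 / ?M)"
    using D pos by (simp add: field_simps)
  finally have d: "cond_mean T r \<mu> (U_site T r w i) (Suc s) \<eta> - cond_mean T r \<mu> (U_site T r w i) s \<eta>
      = (?x - g i) * (1 / ?N - 1 / ?M)" .
  have step: "1 / ?x * (cond_mean T r \<mu> (U_site T r w i) (Suc s) \<eta> - cond_mean T r \<mu> (U_site T r w i) s \<eta>)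
      = (1 - g i / ?x) * (1 / ?N - 1 / ?M)"
    unfolding d using pos by (simp add: field_simps)
  \<comment> \<open>From \<open>s\<close> to \<open>Suc s\<close>, the second summand changes its
    value of \<open>g\<close> and its cylinder. The increment of
    \<open>v p p / (g p)\<^sup>2\<close> accounts exactly for the former, the new term of the sum
    for the latter.\<close>
  have "g i * (?D / (?y * ?x)) + (1 - g i / ?y) / ?N = (1 - g i / ?x) / ?N"
  proof -
    have D': "?D = (?x - ?y) / ?N"
      using D pos by (simp add: field_simps)
    show ?thesis
      unfolding D' using pos by (simp add: field_simps)
  qed
  then show ?case
    using Suc step unfolding K by (simp add: algebra_simps diff_divide_distrib)
qed

section \<open>The complete Martin sum and the ratio of potentials\<close>

lemma martin_sum:
  fixes i :: 'v
  assumes \<eta>: "\<eta> \<in> rays T r"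
  defines "m \<equiv> meet_level T r i \<eta>"
  shows "1 + (\<Sum>k=1..m + 1. 1 / g (\<eta> (k - 1)) *
      (cond_mean T r \<mu> (U_site T r w i) k \<eta> - cond_mean T r \<mu> (U_site T r w i) (k - 1) \<eta>))
    = g i * v (\<eta> m) (\<eta> m) / (g (\<eta> m))\<^sup>2"
proof -
  \<comment> \<open>The mean one level past the separation is \<open>w m\<close>, which is also the
    leading part of the mean at level \<open>m\<close>; only the quotient by the cylinder measure is
    left.\<close>
  have "1 / g (\<eta> m) * (cond_mean T r \<mu> (U_site T r w i) (Suc m) \<eta> - cond_mean T r \<mu> (U_site T r w i) m \<eta>)
      = - (1 - g i / g (\<eta> m)) / measure \<mu> (cyl T r m \<eta>)"
    unfolding m_def cond_mean_beyond[OF \<eta>, of i] cond_mean_above[OF \<eta> order_refl, of i]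
    using v_root_pos[of "\<eta> (meet_level T r i \<eta>)"] cyl_pos[OF \<eta>, of "meet_level T r i \<eta>"]
    by (simp add: field_simps)
  then show ?thesis
    using martin_sum_above[OF \<eta>, of m i] by (simp add: m_def diff_divide_distrib)
qed

lemma potential_ratio_eventually:
  fixes i :: 'v
  assumes \<eta>: "\<eta> \<in> rays T r"
  defines "m \<equiv> meet_level T r i \<eta>"
  shows "\<forall>\<^sub>F j in toward T r \<eta>. potential P X i j / potential P X r j
    = ennreal (g i * v (\<eta> m) (\<eta> m) / (g (\<eta> m))\<^sup>2)"
  unfolding eventually_toward[OF \<eta>]
proof (intro exI[of _ "Suc m"] ballI)
  fix j assume j: "j \<in> below (\<eta> (Suc m))"
  let ?p = "\<eta> m"
  have i: "i \<in> below ?p" "i \<notin> below (\<eta> (Suc m))"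
    unfolding le_meet_level[OF \<eta>, symmetric] by (auto simp: m_def)
  have r: "r \<notin> below (\<eta> (Suc m))"
    using nth_geo_above(1)[of r "\<eta> (Suc m)"] lev_rays[OF \<eta>, of "Suc m"] by auto
  \<comment> \<open>By symmetry the paths are run from \<open>j\<close>. The branch at
    \<open>\<eta> (Suc m)\<close> contains \<open>j\<close> but neither \<open>i\<close> nor
    \<open>r\<close>, so both potentials carry the same probability of hitting \<open>?p\<close>,
    which cancels in the quotient.\<close>
  have 1: "v i j = hit_prob j ?p * v ?p i"
    using v_branch[OF rays_Suc[OF \<eta>] j i(2)] by (simp add: v_sym[of i])
  have 2: "v r j = hit_prob j ?p * g ?p"
    using v_branch[OF rays_Suc[OF \<eta>] j r] by (simp add: v_sym[of r])
  have 3: "v ?p i = g i * v ?p ?p / g ?p"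
    using v_below_root[OF i(1)] v_root_pos[of ?p] by (simp add: v_sym[of i] field_simps)
  have pos: "0 < v r j" "0 < g ?p"
    using v_root_pos v_sym[of r j] by auto
  then have "hit_prob j ?p \<noteq> 0"
    using 2 by auto
  then have "v i j / v r j = g i * v ?p ?p / (g ?p)\<^sup>2"
    using 1 2 3 pos by (simp add: power2_eq_square field_simps)
  then show "potential P X i j / potential P X r j = ennreal (g i * v ?p ?p / (g ?p)\<^sup>2)"
    using pos by (simp add: potential_eq divide_ennreal)
qed

end

theorem theorem4p1:
  fixes T :: "('v :: countable \<times> 'v) set" and r :: 'v and w :: "nat \<Rightarrow> real"
    and P :: "'v \<Rightarrow> 'w measure" and Y :: "nat \<Rightarrow> 'w \<Rightarrow> 'v" and S :: "nat \<Rightarrow> 'w \<Rightarrow> real"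
    and \<theta> :: "'w \<Rightarrow> real" and X :: "real \<Rightarrow> 'w \<Rightarrow> 'v option"
    and \<mu> :: "(nat \<Rightarrow> 'v) measure" and G0 :: "(nat \<Rightarrow> 'v) \<Rightarrow> ennreal"
    and G :: "nat \<Rightarrow> (nat \<Rightarrow> 'v) \<Rightarrow> real"
  assumes tree: "is_tree T" "locally_finite T" "infinite (UNIV :: 'v set)"
    and branches: "\<And>i. succs T r i \<noteq> {}"
    and w: "strict_mono w" "\<And>n. 0 < w n"
    and chain: "minimal_chain (reflected_Q T r w) P Y S"
    and X: "X = chain_path Y S"
    and clock: "exp_clock P Y S \<theta>"
    and transient: "\<P>(\<omega> in P r. \<exists>\<xi>\<in>rays T r. exits_at T r X \<omega> \<xi>) = 1"
    and regular: "\<And>\<eta> i. \<eta> \<in> rays T r \<Longrightarrow>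
      ((\<lambda>j. \<P>(\<omega> in P j. hitting_time X i \<omega> < \<top>)) \<longlongrightarrow> 0) (toward T r \<eta>)"
    and \<mu>: "\<mu> = exit_law T r (P r) X"
    and G0: "G0 = G_zero T r w P X"
    and G: "G = G_lim T r w P X \<theta>"
  shows "(\<forall>\<eta>\<in>rays T r. G0 \<eta> = potential P X r r + ennreal (w 0)) \<and> potential P X r r < \<top>
    \<and> (\<forall>k\<ge>1. \<forall>\<eta>\<in>rays T r.
          ((\<lambda>a. G_killed T r w P X \<theta> a k \<eta>) \<longlongrightarrow> ennreal (G k \<eta>)) at_top
        \<and> 0 < G k \<eta> \<and> G (k + 1) \<eta> \<le> G k \<eta>
        \<and> G k \<eta> = enn2real (G0 \<eta>) - (\<Sum>n<k. Delta w n * measure \<mu> (cyl T r n \<eta>))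
        \<and> (\<lambda>m. Delta w (m + k) * measure \<mu> (cyl T r (m + k) \<eta>)) sums G k \<eta>)
    \<and> (\<forall>k\<ge>1. G k \<in> borel_measurable (boundary_field T r (k - 1)))
    \<and> (\<forall>i. \<forall>\<eta>\<in>rays T r.
          ((\<lambda>j. potential P X i j / potential P X r j) \<longlongrightarrow> ennreal (martin_kernel T r P X i \<eta>))
            (toward T r \<eta>)
        \<and> martin_kernel T r P X i \<eta> =
            1 + (\<Sum>k=1..meet_level T r i \<eta> + 1. 1 / G k \<eta> *
                  (cond_mean T r \<mu> (U_site T r w i) k \<eta>
                   - cond_mean T r \<mu> (U_site T r w i) (k - 1) \<eta>)))"
proof -
  interpret tree_chain T r w P Y S
    by unfold_locales (use tree branches w chain transient regular X in auto)
  \<comment> \<open>The ratio is eventually constant and the filter is nontrivial, so the limit in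
    \<open>martin_kernel\<close> exists and is this constant.\<close>
  have m: "martin_kernel T r P (chain_path Y S) i \<eta> =
      g i * v (\<eta> (meet_level T r i \<eta>)) (\<eta> (meet_level T r i \<eta>)) / (g (\<eta> (meet_level T r i \<eta>)))\<^sup>2"
    "((\<lambda>j. potential P (chain_path Y S) i j / potential P (chain_path Y S) r j)
      \<longlongrightarrow> ennreal (martin_kernel T r P (chain_path Y S) i \<eta>)) (toward T r \<eta>)"
    if \<eta>: "\<eta> \<in> rays T r" for i \<eta>
  proof -
    note lim = tendsto_eventually[OF potential_ratio_eventually[OF \<eta>, of i]]
    show eq: "martin_kernel T r P (chain_path Y S) i \<eta> =
      g i * v (\<eta> (meet_level T r i \<eta>)) (\<eta> (meet_level T r i \<eta>)) / (g (\<eta> (meet_level T r i \<eta>)))\<^sup>2"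
      unfolding martin_kernel_def tendsto_Lim[OF toward_neq_bot[OF \<eta>] lim] by simp
    show "((\<lambda>j. potential P (chain_path Y S) i j / potential P (chain_path Y S) r j)
      \<longlongrightarrow> ennreal (martin_kernel T r P (chain_path Y S) i \<eta>)) (toward T r \<eta>)"
      unfolding eq by (rule lim)
  qed
  show ?thesis
    unfolding X G0 \<mu> G
  proof (intro conjI ballI allI impI)
    fix \<eta> assume \<eta>: "\<eta> \<in> rays T r"
    show "G_zero T r w P (chain_path Y S) \<eta> = potential P (chain_path Y S) r r + ennreal (w 0)"
      using w by (simp add: G_zero_eq[OF \<eta>] potential_eq less_imp_le)
  next
    show "potential P (chain_path Y S) r r < \<top>"
      by (rule potential_root_finite)
  next
    fix k \<eta> assume "1 \<le> (k :: nat)" and \<eta>: "\<eta> \<in> rays T r"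
    \<comment> \<open>\<open>G\<close> at time \<open>k\<close> is \<open>g\<close> at level
      \<open>k - 1\<close>, so the predecessor is the working index.\<close>
    then obtain l where k: "k = Suc l"
      by (cases k) auto
    note G_eq = G_lim_eq[OF \<eta> clock]
    show "((\<lambda>a. G_killed T r w P (chain_path Y S) \<theta> a k \<eta>)
        \<longlongrightarrow> ennreal (G_lim T r w P (chain_path Y S) \<theta> k \<eta>)) at_top"
      unfolding k G_eq by (rule G_killed_tendsto[OF \<eta> clock])
    show "0 < G_lim T r w P (chain_path Y S) \<theta> k \<eta>"
      unfolding k G_eq by (rule v_root_pos)
    show "G_lim T r w P (chain_path Y S) \<theta> (k + 1) \<eta> \<le> G_lim T r w P (chain_path Y S) \<theta> k \<eta>"
      using ray_flow[OF \<eta>, of l] Delta_w_pos[of "Suc l"] cyl_pos[OF \<eta>, of "Suc l"]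
      by (simp add: k G_eq) (smt (verit) mult_pos_pos)
    show "G_lim T r w P (chain_path Y S) \<theta> k \<eta> = enn2real (G_zero T r w P (chain_path Y S) \<eta>)
        - (\<Sum>n<k. Delta w n * measure (exit_law T r (P r) (chain_path Y S)) (cyl T r n \<eta>))"
      unfolding k partial_sum[OF \<eta>] using w by (simp add: G_eq G_zero_eq[OF \<eta>] less_imp_le del: ennreal_plus)
    show "(\<lambda>m. Delta w (m + k) * measure (exit_law T r (P r) (chain_path Y S)) (cyl T r (m + k) \<eta>))
        sums G_lim T r w P (chain_path Y S) \<theta> k \<eta>"
      unfolding k G_eq by (rule tail_sums[OF \<eta>])
  next
    fix k :: nat assume "1 \<le> k"
    then obtain l where k: "k = Suc l"
      by (cases k) auto
    show "G_lim T r w P (chain_path Y S) \<theta> k \<in> borel_measurable (boundary_field T r (k - 1))"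
      using boundary_field_measurable[of g l]
      by (subst measurable_cong[where g = "\<lambda>\<eta>. g (\<eta> l)"])
        (auto simp: k boundary_field_space G_lim_eq[OF _ clock])
  next
    fix i \<eta> assume \<eta>: "\<eta> \<in> rays T r"
    show "((\<lambda>j. potential P (chain_path Y S) i j / potential P (chain_path Y S) r j)
      \<longlongrightarrow> ennreal (martin_kernel T r P (chain_path Y S) i \<eta>)) (toward T r \<eta>)"
      by (rule m(2)[OF \<eta>])
    have "G_lim T r w P (chain_path Y S) \<theta> k \<eta> = g (\<eta> (k - 1))" if "k \<in> {1..n}" for k n
      using G_lim_eq[OF \<eta> clock, of "k - 1"] that by simp
    then show "martin_kernel T r P (chain_path Y S) i \<eta> =
        1 + (\<Sum>k=1..meet_level T r i \<eta> + 1. 1 / G_lim T r w P (chain_path Y S) \<theta> k \<eta> *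
          (cond_mean T r (exit_law T r (P r) (chain_path Y S)) (U_site T r w i) k \<eta>
            - cond_mean T r (exit_law T r (P r) (chain_path Y S)) (U_site T r w i) (k - 1) \<eta>))"
      unfolding m(1)[OF \<eta>] martin_sum[OF \<eta>, symmetric]
      by (intro arg_cong2[where f = "(+)"] sum.cong refl) auto
  qed
qed

end
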